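(* Let $L$ be a field, let $A$ be an $L$-algebra, and let $K\subseteq L$ be a subfield. Then $A$ is amenable as a $K$-algebra if and only if $A$ is amenable as an $L$-algebra. Likewise, $A$ is fully amenable as a $K$-algebra if and only if $A$ is fully amenable as an $L$-algebra.
   Context: Algebras are associative and unital, not necessarily commutative; modules are unital left modules. If $A$ is an algebra over a field $F$, every $A$-module $M$ is an $F$-vector space via $F\to A$. If $K\subseteq L$ is a subfield, an $L$-algebra $A$ is also a $K$-algebra by restriction of scalars. Let $F$ be a field, $A$ an $F$-algebra and $M$ an $A$-module. Given $a_1,\dots,a_r\in A$ and a real $\varepsilon>0$, a non-zero finite-dimensional $F$-subspace $V\leq M$ is called $\varepsilon$-almost invariant with respect to $a_1,\dots,a_r$ if $$\dim_F(V+a_1V+\dots+a_rV)\leq (1+\varepsilon)\dim_F V.$$ The module $M$ is amenable over the $F$-algebra $A$ if for every finite list $a_1,\dots,a_r\in A$ and every $\varepsilon>0$, $M$ admits an $F$-subspace that is $\varepsilon$-almost invariant with respect to $a_1,\dots,a_r$. The $F$-algebra $A$ is amenable if it is amenable as a left module over itself. The $F$-algebra $A$ is fully amenable if all of its non-zero modules are amenable. *)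

theory Defs
  imports Complex_Main "HOL-Algebra.AbelCoset" "HOL-Algebra.Subrings" "Jordan_Normal_Form.Missing_VectorSpace"
begin

text \<open>
  HOL-Algebra's \<open>algebra\<close> and \<open>module\<close> require commutative rings, so associative algebras over a
  field and left modules over a not necessarily commutative ring are introduced here. Rings may be
  zero rings. In a record of type \<open>module\<close> that is only used as a module, the fields \<open>mult\<close> and
  \<open>one\<close> are irrelevant.
\<close>

locale assoc_algebra = F?: field F + A?: ring A + module F A
  for F :: "('f, 'y) ring_scheme" (structure) and A :: "('f, 'a, 'x) module_scheme" (structure) +
  assumes smult_mult_left:
      "\<lbrakk>c \<in> carrier F; x \<in> carrier A; y \<in> carrier A\<rbrakk> \<Longrightarrow>
        (c \<odot>\<^bsub>A\<^esub> x) \<otimes>\<^bsub>A\<^esub> y = c \<odot>\<^bsub>A\<^esub> (x \<otimes>\<^bsub>A\<^esub> y)"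
    and smult_mult_right:
      "\<lbrakk>c \<in> carrier F; x \<in> carrier A; y \<in> carrier A\<rbrakk> \<Longrightarrow>
        x \<otimes>\<^bsub>A\<^esub> (c \<odot>\<^bsub>A\<^esub> y) = c \<odot>\<^bsub>A\<^esub> (x \<otimes>\<^bsub>A\<^esub> y)"

locale left_module = A?: ring A + M?: abelian_group M
  for A :: "('a, 'x) ring_scheme" (structure) and M :: "('a, 'm, 'y) module_scheme" (structure) +
  assumes act_closed:
      "\<lbrakk>a \<in> carrier A; x \<in> carrier M\<rbrakk> \<Longrightarrow> a \<odot>\<^bsub>M\<^esub> x \<in> carrier M"
    and act_l_distr:
      "\<lbrakk>a \<in> carrier A; b \<in> carrier A; x \<in> carrier M\<rbrakk> \<Longrightarrow>
        (a \<oplus>\<^bsub>A\<^esub> b) \<odot>\<^bsub>M\<^esub> x = a \<odot>\<^bsub>M\<^esub> x \<oplus>\<^bsub>M\<^esub> b \<odot>\<^bsub>M\<^esub> x"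
    and act_r_distr:
      "\<lbrakk>a \<in> carrier A; x \<in> carrier M; y \<in> carrier M\<rbrakk> \<Longrightarrow>
        a \<odot>\<^bsub>M\<^esub> (x \<oplus>\<^bsub>M\<^esub> y) = a \<odot>\<^bsub>M\<^esub> x \<oplus>\<^bsub>M\<^esub> a \<odot>\<^bsub>M\<^esub> y"
    and act_assoc:
      "\<lbrakk>a \<in> carrier A; b \<in> carrier A; x \<in> carrier M\<rbrakk> \<Longrightarrow>
        (a \<otimes>\<^bsub>A\<^esub> b) \<odot>\<^bsub>M\<^esub> x = a \<odot>\<^bsub>M\<^esub> (b \<odot>\<^bsub>M\<^esub> x)"
    and act_one:
      "x \<in> carrier M \<Longrightarrow> \<one>\<^bsub>A\<^esub> \<odot>\<^bsub>M\<^esub> x = x"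

definition regular_module :: "('f, 'a, 'x) module_scheme \<Rightarrow> ('a, 'a) module" where
  "regular_module A =
    \<lparr>carrier = carrier A, mult = mult A, one = one A, zero = zero A, add = add A, smult = mult A\<rparr>"

text \<open>
  The vector space underlying an \<open>A\<close>-module: scalars act through the structure map
  \<open>c \<mapsto> c \<cdot> 1\<close> from the base field to \<open>A\<close>. The base field enters only through its carrier, hence
  does not occur as a parameter.
\<close>
definition underlying_vs :: "('f, 'a, 'x) module_scheme \<Rightarrow> ('a, 'm) module \<Rightarrow> ('f, 'm) module" where
  "underlying_vs A M =
    \<lparr>carrier = carrier M, mult = mult M, one = one M, zero = zero M, add = add M,
     smult = (\<lambda>c x. (c \<odot>\<^bsub>A\<^esub> \<one>\<^bsub>A\<^esub>) \<odot>\<^bsub>M\<^esub> x)\<rparr>"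

text \<open>\<open>V + a\<^sub>1 V + \<dots> + a\<^sub>r V\<close>\<close>
definition translate_sum :: "('a, 'm) module \<Rightarrow> 'a list \<Rightarrow> 'm set \<Rightarrow> 'm set" where
  "translate_sum M as V = foldl (\<lambda>W a. W <+>\<^bsub>M\<^esub> (\<lambda>v. a \<odot>\<^bsub>M\<^esub> v) ` V) V as"

definition almost_invariant ::
  "'f ring \<Rightarrow> ('f, 'a, 'x) module_scheme \<Rightarrow> ('a, 'm) module \<Rightarrow> 'a list \<Rightarrow> real \<Rightarrow> 'm set \<Rightarrow> bool" where
  "almost_invariant F A M as \<epsilon> V \<longleftrightarrow>
    (let S = underlying_vs A M; dim = (\<lambda>W. vectorspace.dim F (S\<lparr>carrier := W\<rparr>)) in
      subspace F V S \<and> V \<noteq> {\<zero>\<^bsub>M\<^esub>} \<and> vectorspace.fin_dim F (S\<lparr>carrier := V\<rparr>) \<and>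
      real (dim (translate_sum M as V)) \<le> (1 + \<epsilon>) * real (dim V))"

definition amenable_module ::
  "'f ring \<Rightarrow> ('f, 'a, 'x) module_scheme \<Rightarrow> ('a, 'm) module \<Rightarrow> bool" where
  "amenable_module F A M \<longleftrightarrow>
    (\<forall>as \<epsilon>. set as \<subseteq> carrier A \<and> \<epsilon> > 0 \<longrightarrow> (\<exists>V. almost_invariant F A M as \<epsilon> V))"

definition amenable_algebra :: "'f ring \<Rightarrow> ('f, 'a, 'x) module_scheme \<Rightarrow> bool" where
  "amenable_algebra F A \<longleftrightarrow> amenable_module F A (regular_module A)"

text \<open>
  HOL cannot quantify over types inside a formula, so the type \<open>'m\<close> whose subsets serve as carriers
  of modules is an explicit parameter. A statement with \<open>'m\<close> free holds for modules of any size.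
\<close>
definition fully_amenable_algebra ::
  "'m itself \<Rightarrow> 'f ring \<Rightarrow> ('f, 'a, 'x) module_scheme \<Rightarrow> bool" where
  "fully_amenable_algebra T F A \<longleftrightarrow>
    (\<forall>M :: ('a, 'm) module.
      left_module A M \<and> carrier M \<noteq> {\<zero>\<^bsub>M\<^esub>} \<longrightarrow> amenable_module F A M)"

lemma (in assoc_algebra) left_module_regular: "left_module A (regular_module A)"
proof -
  have "abelian_group (regular_module A)"
    by (intro abelian_groupI)
       (auto simp: regular_module_def A.a_ac intro: bexI[where x = "\<ominus>\<^bsub>A\<^esub> x" for x] A.l_neg)
  then show ?thesis
    by (intro left_module.intro A.ring_axioms left_module_axioms.intro)
       (auto simp: regular_module_def A.l_distr A.r_distr A.m_assoc)
qed

lemma (in assoc_algebra) vectorspace_underlying: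
  assumes "left_module A M"
  shows "vectorspace F (underlying_vs A M)"
proof -
  interpret M: left_module A M by (rule assms)
  have ag: "abelian_group (underlying_vs A M)"
    by (intro abelian_groupI)
       (auto simp: underlying_vs_def M.M.a_ac intro: bexI[where x = "\<ominus>\<^bsub>M\<^esub> x" for x] M.M.l_neg)
  have mult: "((c \<otimes>\<^bsub>F\<^esub> d) \<odot>\<^bsub>A\<^esub> \<one>\<^bsub>A\<^esub>) = (c \<odot>\<^bsub>A\<^esub> \<one>\<^bsub>A\<^esub>) \<otimes>\<^bsub>A\<^esub> (d \<odot>\<^bsub>A\<^esub> \<one>\<^bsub>A\<^esub>)"
    if "c \<in> carrier F" "d \<in> carrier F" for c d
    using that by (simp add: smult_mult_left smult_assoc1)
  have "module F (underlying_vs A M)"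
    by (intro moduleI ag is_cring)
       (auto simp: underlying_vs_def smult_l_distr mult M.act_closed M.act_l_distr M.act_r_distr
          M.act_assoc M.act_one)
  then show ?thesis
    by (intro vectorspace.intro field_axioms)
qed

lemma (in assoc_algebra) restrict_scalars:
  assumes "subfield K F"
  shows "assoc_algebra (F\<lparr>carrier := K\<rparr>) A"
proof -
  have K: "K \<subseteq> carrier F" using subfieldE(3)[OF assms] .
  interpret K: field "F\<lparr>carrier := K\<rparr>" using F.subfield_iff(2)[OF assms] .
  have "module (F\<lparr>carrier := K\<rparr>) A"
    by (intro moduleI K.is_cring A.abelian_group_axioms)
       (use K in \<open>auto simp: subset_iff smult_l_distr smult_r_distr smult_assoc1\<close>)
  then show ?thesis
    by (intro assoc_algebra.intro K.field_axioms A.ring_axioms assoc_algebra_axioms.intro)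
       (use K in \<open>auto simp: smult_mult_left smult_mult_right\<close>)
qed

end

theory Submission
  imports Defs
begin

text \<open>
  Amenability is insensitive to the base field module by module, which gives both equivalences at
  once. An element of the algebra acts on a module by an \<open>L\<close>-linear map, so the question is about a
  finite set \<open>\<T>\<close> of linear endomorphisms of an \<open>L\<close>-space \<open>S\<close>: almost invariant \<open>L\<close>-subspaces have to be
  turned into almost invariant \<open>K\<close>-subspaces and conversely. Here \<open>L\<close> may have infinite dimension
  over \<open>K\<close>.

  From \<open>L\<close> to \<open>K\<close>: let \<open>V\<close> be an \<open>L\<close>-subspace with basis \<open>v\<^sub>1, \<dots>, v\<^sub>n\<close> whose images lie in \<open>W\<close> with
  basis \<open>w\<^sub>1, \<dots>, w\<^sub>m\<close>. Only finitely many scalars \<open>c\<close> occur when the images of the \<open>v\<^sub>i\<close> are written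
  in terms of the \<open>w\<^sub>j\<close>. A commutative algebra generated by finitely many elements has polynomial
  growth, hence \<open>L\<close> contains \<open>K\<close>-subspaces \<open>P\<close> and \<open>Q\<close> of almost equal dimension with \<open>c P \<subseteq> Q\<close> for
  these \<open>c\<close> (\<open>field_extension_almost_invariant\<close>). Then \<open>P v\<^sub>1 + \<dots> + P v\<^sub>n\<close> is mapped into
  \<open>Q w\<^sub>1 + \<dots> + Q w\<^sub>m\<close>, and the dimensions are \<open>n dim P\<close> and at most \<open>m dim Q\<close>.

  From \<open>K\<close> to \<open>L\<close>: the \<open>L\<close>-subspace generated by an almost invariant \<open>K\<close>-subspace \<open>V\<close> need not be
  almost invariant, because directions in which \<open>V\<close> is dense and directions in which it is thin count
  equally in it. Hence \<open>V\<close> has to be cut into levels of different density. For a real \<open>t > 0\<close> let \<open>V\<^sub>t\<close> be the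
  largest \<open>L\<close>-subspace \<open>U\<close> that maximises \<open>dim\<^sub>K (V \<inter> U) - t dim\<^sub>L U\<close>; these spaces are the steps of
  the Harder-Narasimhan filtration of \<open>V\<close> with respect to the slope \<open>dim\<^sub>K (V \<inter> U) / dim\<^sub>L U\<close>. They
  depend functorially on \<open>V\<close>: an \<open>L\<close>-linear map that takes \<open>V\<close> into \<open>V'\<close> takes \<open>V\<^sub>t\<close> into \<open>V'\<^sub>t\<close>
  (\<open>optimal_functorial\<close>). Moreover \<open>\<integral> dim\<^sub>L V\<^sub>t dt = dim\<^sub>K V\<close>, so if \<open>dim\<^sub>K V'\<close> exceeds \<open>dim\<^sub>K V\<close> by a
  small factor only, then some level \<open>t\<close> has \<open>V\<^sub>t \<noteq> 0\<close> and \<open>dim\<^sub>L V'\<^sub>t\<close> at most a small factor above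
  \<open>dim\<^sub>L V\<^sub>t\<close>. The integral is replaced by a sum over the values \<open>t = k / N\<close> for a large \<open>N\<close>, which
  costs an arbitrarily small factor (\<open>telescoping_ratio\<close>).

  The only linear algebra behind both directions is the formula
  \<open>dim (Y + T X) + dim {x \<in> X. T x \<in> Y} = dim Y + dim X\<close> (\<open>rank_formula\<close>).
\<close>

section \<open>Finite-dimensional subspaces\<close>

definition fd_subspace :: "('f, 'y) ring_scheme \<Rightarrow> ('f, 'm, 'z) module_scheme \<Rightarrow> 'm set \<Rightarrow> bool" where
  "fd_subspace F V W \<longleftrightarrow> subspace F W V \<and> vectorspace.fin_dim F (V\<lparr>carrier := W\<rparr>)"

definition subdim :: "('f, 'y) ring_scheme \<Rightarrow> ('f, 'm, 'z) module_scheme \<Rightarrow> 'm set \<Rightarrow> nat" where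
  "subdim F V W = vectorspace.dim F (V\<lparr>carrier := W\<rparr>)"

context vectorspace
begin

lemma subspaceI:
  assumes "W \<subseteq> carrier V" "\<zero>\<^bsub>V\<^esub> \<in> W"
    and "\<And>x y. \<lbrakk>x \<in> W; y \<in> W\<rbrakk> \<Longrightarrow> x \<oplus>\<^bsub>V\<^esub> y \<in> W"
    and "\<And>c x. \<lbrakk>c \<in> carrier K; x \<in> W\<rbrakk> \<Longrightarrow> c \<odot>\<^bsub>V\<^esub> x \<in> W"
  shows "subspace K W V"
  using assms by (intro subspace.intro submodule.intro vectorspace_axioms module_axioms) auto

lemma subspaceD:
  assumes "subspace K W V"
  shows "W \<subseteq> carrier V" "\<zero>\<^bsub>V\<^esub> \<in> W"
    and "\<And>x y. \<lbrakk>x \<in> W; y \<in> W\<rbrakk> \<Longrightarrow> x \<oplus>\<^bsub>V\<^esub> y \<in> W"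
    and "\<And>c x. \<lbrakk>c \<in> carrier K; x \<in> W\<rbrakk> \<Longrightarrow> c \<odot>\<^bsub>V\<^esub> x \<in> W"
  using assms unfolding subspace_def submodule_def by auto

lemma subspace_minus:
  assumes "subspace K W V" "x \<in> W" "y \<in> W"
  shows "x \<ominus>\<^bsub>V\<^esub> y \<in> W"
proof -
  have "(\<ominus>\<^bsub>K\<^esub> \<one>\<^bsub>K\<^esub>) \<odot>\<^bsub>V\<^esub> y \<in> W" using subspaceD[OF assms(1)] assms(3) by auto
  moreover have "(\<ominus>\<^bsub>K\<^esub> \<one>\<^bsub>K\<^esub>) \<odot>\<^bsub>V\<^esub> y = \<ominus>\<^bsub>V\<^esub> y"
    using subspaceD(1)[OF assms(1)] assms(3) smult_minus_1 by auto
  ultimately show ?thesis using subspaceD(3)[OF assms(1,2)] by (simp add: a_minus_def)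
qed

lemma subspace_Int:
  assumes "subspace K W V" "subspace K X V"
  shows "subspace K (W \<inter> X) V"
  using subspaceD[OF assms(1)] subspaceD[OF assms(2)] by (intro subspaceI) auto

lemma finite_basis_of_fd_subspace:
  assumes "fd_subspace K V W"
  obtains B where "finite B" "B \<subseteq> W" "lin_indpt B" "span B = W" "subdim K V W = card B"
proof -
  have sub: "subspace K W V" and fin: "vectorspace.fin_dim K (vs W)"
    using assms by (auto simp: fd_subspace_def)
  interpret W: vectorspace K "vs W" by (rule subspace_is_vs[OF sub])
  obtain B where B: "finite B" "W.basis B" using W.finite_basis_exists fin by blast
  then have "B \<subseteq> W" by (simp add: W.basis_def)
  moreover note span_li_not_depend[OF this is_module[OF sub]]
  ultimately show thesis
    using that[of B] B W.dim_basis[OF B] by (simp add: W.basis_def subdim_def)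
qed

lemma fd_subspace_span:
  assumes "finite B" "B \<subseteq> carrier V"
  shows "fd_subspace K V (span B)" "subdim K V (span B) \<le> card B"
    "lin_indpt B \<Longrightarrow> subdim K V (span B) = card B"
proof -
  have sub: "subspace K (span B) V" by (rule span_is_subspace[OF assms(2)])
  interpret W: vectorspace K "vs (span B)" by (rule subspace_is_vs[OF sub])
  have BW: "B \<subseteq> span B" by (rule in_own_span[OF assms(2)])
  note eq = span_li_not_depend[OF this is_module[OF sub]]
  have gen: "W.span B = carrier (vs (span B))" using eq by simp
  show "fd_subspace K V (span B)"
    unfolding fd_subspace_def W.fin_dim_def using sub assms(1) BW gen by auto
  show "subdim K V (span B) \<le> card B"
    unfolding subdim_def using W.gen_ge_dim[OF assms(1)] BW gen by simp
  show "lin_indpt B \<Longrightarrow> subdim K V (span B) = card B"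
    unfolding subdim_def using W.dim_basis[OF assms(1)] BW gen eq by (simp add: W.basis_def)
qed

lemma lin_indpt_card_le_subdim:
  assumes "fd_subspace K V W" "A \<subseteq> W" "lin_indpt A"
  shows "finite A" "card A \<le> subdim K V W"
proof -
  have sub: "subspace K W V" and fin: "vectorspace.fin_dim K (vs W)"
    using assms by (auto simp: fd_subspace_def)
  interpret W: vectorspace K "vs W" by (rule subspace_is_vs[OF sub])
  note eq = span_li_not_depend[OF assms(2) is_module[OF sub]]
  show "finite A" "card A \<le> subdim K V W"
    using W.li_le_dim[OF fin, of A] assms eq by (auto simp: subdim_def)
qed

text \<open>
  A linearly independent subset of \<open>X\<close> that is maximal, which exists because its size is bounded
  by the dimension of \<open>W\<close>, is a basis of \<open>X\<close>.
\<close>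
lemma fd_subspace_subset:
  assumes W: "fd_subspace K V W" and X: "subspace K X V" "X \<subseteq> W"
  shows "fd_subspace K V X" "subdim K V X \<le> subdim K V W"
    and "subdim K V W \<le> subdim K V X \<Longrightarrow> X = W"
proof -
  have sW: "subspace K W V" using W by (simp add: fd_subspace_def)
  have Wc: "W \<subseteq> carrier V" using subspaceD(1)[OF sW] .
  define P where "P = (\<lambda>A. A \<subseteq> X \<and> lin_indpt A)"
  have "P A \<Longrightarrow> finite A \<and> card A \<le> subdim K V W" for A
    using lin_indpt_card_le_subdim[OF W, of A] X(2) by (auto simp: P_def)
  moreover have "P {}" by (auto simp: P_def lin_dep_def)
  ultimately obtain B where B: "finite B" "maximal B P" using maximal_exists[of P _ "{}"] by metis
  then have BX: "B \<subseteq> X" "lin_indpt B" by (auto simp: maximal_def P_def)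
  have "span B \<subseteq> X" using span_is_subset[OF BX(1)] X(1) by simp
  moreover have "X \<subseteq> span B"
  proof
    fix x assume x: "x \<in> X"
    show "x \<in> span B"
    proof (rule ccontr)
      assume n: "x \<notin> span B"
      have Bc: "B \<subseteq> carrier V" using BX X Wc by auto
      have "x \<notin> B" using n in_own_span[OF Bc] by auto
      moreover have "x \<in> carrier V" using x X Wc by auto
      ultimately have "P (B \<union> {x})"
        using lin_dep_iff_in_span[OF Bc BX(2)] n x BX(1) by (simp add: P_def)
      then have "B \<union> {x} = B" using B(2) unfolding maximal_def by blast
      then show False using \<open>x \<notin> B\<close> by auto
    qed
  qed
  ultimately have sp: "span B = X" by auto
  have Bc: "B \<subseteq> carrier V" using BX X Wc by auto
  show "fd_subspace K V X" using fd_subspace_span(1)[OF B(1) Bc] sp by simp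
  have d: "subdim K V X = card B" using fd_subspace_span(3)[OF B(1) Bc BX(2)] sp by simp
  show "subdim K V X \<le> subdim K V W"
    using lin_indpt_card_le_subdim[OF W] BX X d by auto
  show "X = W" if "subdim K V W \<le> subdim K V X"
  proof (rule ccontr)
    assume "X \<noteq> W"
    then obtain w where w: "w \<in> W" "w \<notin> span B" using X(2) sp by auto
    then have "w \<notin> B" using in_own_span[OF Bc] by auto
    then have "lin_indpt (B \<union> {w})"
      using lin_dep_iff_in_span[OF Bc BX(2)] w Wc by auto
    then have "card (B \<union> {w}) \<le> subdim K V W"
      using lin_indpt_card_le_subdim[OF W, of "B \<union> {w}"] BX X w by auto
    then show False using \<open>w \<notin> B\<close> B(1) d that by simp
  qed
qed

lemma fd_subspace_zero: "fd_subspace K V {\<zero>\<^bsub>V\<^esub>}" "subdim K V {\<zero>\<^bsub>V\<^esub>} = 0"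
  using fd_subspace_span[of "{}"] by (auto simp: span_empty)

lemma subdim_eq_0_iff:
  assumes "fd_subspace K V W"
  shows "subdim K V W = 0 \<longleftrightarrow> W = {\<zero>\<^bsub>V\<^esub>}"
proof
  assume "subdim K V W = 0"
  moreover have "subspace K {\<zero>\<^bsub>V\<^esub>} V" using fd_subspace_zero by (simp add: fd_subspace_def)
  ultimately show "W = {\<zero>\<^bsub>V\<^esub>}"
    using fd_subspace_subset(3)[OF assms, of "{\<zero>\<^bsub>V\<^esub>}"] subspaceD(2)[of W] assms
    by (auto simp: fd_subspace_def)
qed (simp add: fd_subspace_zero)

definition adjoin :: "'c set \<Rightarrow> 'c \<Rightarrow> 'c set" where
  "adjoin W w = {y \<oplus>\<^bsub>V\<^esub> c \<odot>\<^bsub>V\<^esub> w | y c. y \<in> W \<and> c \<in> carrier K}"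

lemma adjoin_incl:
  assumes "W \<subseteq> carrier V" "w \<in> carrier V"
  shows "W \<subseteq> adjoin W w"
proof
  fix y assume "y \<in> W"
  then have "y = y \<oplus>\<^bsub>V\<^esub> \<zero>\<^bsub>K\<^esub> \<odot>\<^bsub>V\<^esub> w" using assms by auto
  then show "y \<in> adjoin W w" using \<open>y \<in> W\<close> unfolding adjoin_def by blast
qed

lemma fd_subspace_adjoin:
  assumes W: "fd_subspace K V W" and w: "w \<in> carrier V" "w \<notin> W"
  shows "fd_subspace K V (adjoin W w)" "subdim K V (adjoin W w) = Suc (subdim K V W)"
proof -
  obtain B where B: "finite B" "B \<subseteq> W" "lin_indpt B" "span B = W" "subdim K V W = card B"
    using finite_basis_of_fd_subspace[OF W] .
  have Wc: "W \<subseteq> carrier V" using W subspaceD(1) by (auto simp: fd_subspace_def)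
  then have Bc: "B \<subseteq> carrier V" using B by auto
  have "adjoin W w = submodule_sum (span B) (span {w})"
  proof -
    have "span {w} = {c \<odot>\<^bsub>V\<^esub> w | c. c \<in> carrier K}"
    proof -
      have "lincomb a {w} = a w \<odot>\<^bsub>V\<^esub> w" if "a \<in> {w} \<rightarrow> carrier K" for a
        using that w unfolding lincomb_def by auto
      then have "span {w} = {a w \<odot>\<^bsub>V\<^esub> w | a. a \<in> {w} \<rightarrow> carrier K}"
        using finite_span[of "{w}"] w by auto metis
      also have "\<dots> = {c \<odot>\<^bsub>V\<^esub> w | c. c \<in> carrier K}"
        by (auto intro: exI[where x = "\<lambda>_. c" for c])
      finally show ?thesis .
    qed
    then show ?thesis unfolding adjoin_def submodule_sum_def B(4) by auto
  qed
  also have "\<dots> = span (B \<union> {w})" using span_union_is_sum[OF Bc, of "{w}"] w by simp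
  finally have sp: "adjoin W w = span (insert w B)" by simp
  have "w \<notin> B" using B w by auto
  then have "lin_indpt (insert w B)"
    using lin_dep_iff_in_span[OF Bc B(3) w(1)] B(4) w(2) by auto
  then show "fd_subspace K V (adjoin W w)" "subdim K V (adjoin W w) = Suc (subdim K V W)"
    using fd_subspace_span[of "insert w B"] B w(1) Bc \<open>w \<notin> B\<close> sp by auto
qed

end

text \<open>
  For \<open>Y = {0}\<close> this is the rank-nullity theorem, and for the identity map it is the modular law
  for dimensions. Starting from \<open>Z = {x \<in> X. T x \<in> Y}\<close>, where \<open>Y + T Z = Y\<close>, the space \<open>Z\<close> is enlarged
  to \<open>X\<close> by one vector at a time; a vector outside the space reached so far has its image outside
  the corresponding sum, so both dimensions on the two sides grow by one.
\<close>
lemma rank_formula: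
  assumes "vectorspace K V" "vectorspace K W" "T \<in> module_hom K V W"
    and X: "fd_subspace K V X" and Y: "fd_subspace K W Y"
  shows "fd_subspace K W (Y <+>\<^bsub>W\<^esub> T ` X)"
    and "subdim K W (Y <+>\<^bsub>W\<^esub> T ` X) + subdim K V {x \<in> X. T x \<in> Y} = subdim K W Y + subdim K V X"
proof -
  interpret linear_map K V W T
    using assms(1-3) by (intro linear_map.intro mod_hom.intro mod_hom_axioms.intro) (auto simp: vectorspace_def)
  have sX: "subspace K X V" and sY: "subspace K Y W" using X Y by (auto simp: fd_subspace_def)
  note X' = V.subspaceD[OF sX] and Y' = W.subspaceD[OF sY]
  define Z where "Z = {x \<in> X. T x \<in> Y}"
  have sZ: "subspace K Z V"
    using X' Y' unfolding Z_def by (intro V.subspaceI) (auto simp: subset_iff)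
  have Z: "fd_subspace K V Z" using V.fd_subspace_subset(1)[OF X sZ] by (auto simp: Z_def)
  define good where "good = (\<lambda>X0. Z \<subseteq> X0 \<and> X0 \<subseteq> X \<and> fd_subspace K V X0 \<and>
    fd_subspace K W (Y <+>\<^bsub>W\<^esub> T ` X0) \<and>
    subdim K W (Y <+>\<^bsub>W\<^esub> T ` X0) + subdim K V Z = subdim K W Y + subdim K V X0)"
  have "Y <+>\<^bsub>W\<^esub> T ` Z = Y"
  proof
    show "Y <+>\<^bsub>W\<^esub> T ` Z \<subseteq> Y" using Y' by (auto simp: set_add_def' Z_def)
    show "Y \<subseteq> Y <+>\<^bsub>W\<^esub> T ` Z"
    proof
      fix y assume "y \<in> Y"
      then have "y = y \<oplus>\<^bsub>W\<^esub> T \<zero>\<^bsub>V\<^esub>" using Y' by auto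
      moreover have "\<zero>\<^bsub>V\<^esub> \<in> Z" using V.subspaceD(2)[OF sZ] .
      ultimately show "y \<in> Y <+>\<^bsub>W\<^esub> T ` Z" using \<open>y \<in> Y\<close> unfolding set_add_def' by blast
    qed
  qed
  then have "good Z" using Z Y by (auto simp: good_def Z_def)
  moreover have "\<forall>X0. good X0 \<longrightarrow> subdim K V X0 < Suc (subdim K V X)"
  proof (intro allI impI)
    fix X0 assume "good X0"
    then show "subdim K V X0 < Suc (subdim K V X)"
      using V.fd_subspace_subset(2)[OF X, of X0] by (auto simp: good_def fd_subspace_def)
  qed
  ultimately obtain X0 where X0: "good X0" and max: "\<And>X1. good X1 \<Longrightarrow> subdim K V X1 \<le> subdim K V X0"
    using ex_has_greatest_nat[of good Z "subdim K V"] by blast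
  then have fX0: "fd_subspace K V X0" and fY0: "fd_subspace K W (Y <+>\<^bsub>W\<^esub> T ` X0)"
    and ZX0: "Z \<subseteq> X0" and X0X: "X0 \<subseteq> X" by (auto simp: good_def)
  have sX0: "subspace K X0 V" using fX0 by (simp add: fd_subspace_def)
  note X0' = V.subspaceD[OF sX0]
  have "X0 = X"
  proof (rule ccontr)
    assume "X0 \<noteq> X"
    then obtain x where x: "x \<in> X" "x \<notin> X0" using X0X by auto
    then have xc: "x \<in> carrier V" using X' by auto
    have "T x \<notin> Y <+>\<^bsub>W\<^esub> T ` X0"
    proof
      assume "T x \<in> Y <+>\<^bsub>W\<^esub> T ` X0"
      then obtain y x0 where y: "y \<in> Y" "x0 \<in> X0" "T x = y \<oplus>\<^bsub>W\<^esub> T x0"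
        by (auto simp: set_add_def')
      then have x0c: "x0 \<in> carrier V" and yc: "y \<in> carrier W" using X0' Y' by auto
      have "T (x \<ominus>\<^bsub>V\<^esub> x0) = (y \<oplus>\<^bsub>W\<^esub> T x0) \<ominus>\<^bsub>W\<^esub> T x0" using xc x0c y by simp
      also have "\<dots> = y" using yc x0c by (simp add: a_minus_def W.module.M.a_assoc W.module.M.r_neg)
      finally have "x \<ominus>\<^bsub>V\<^esub> x0 \<in> Z"
        using y x X0X V.subspace_minus[OF sX] by (auto simp: Z_def)
      then have "(x \<ominus>\<^bsub>V\<^esub> x0) \<oplus>\<^bsub>V\<^esub> x0 \<in> X0" using ZX0 X0' y by auto
      moreover have "(x \<ominus>\<^bsub>V\<^esub> x0) \<oplus>\<^bsub>V\<^esub> x0 = x"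
        using xc x0c by (simp add: a_minus_def V.module.M.a_assoc V.module.M.l_neg)
      ultimately show False using x by simp
    qed
    note step = V.fd_subspace_adjoin[OF fX0 xc x(2)] W.fd_subspace_adjoin[OF fY0 _ this]
    have "Y <+>\<^bsub>W\<^esub> T ` V.adjoin X0 x = W.adjoin (Y <+>\<^bsub>W\<^esub> T ` X0) (T x)"
    proof -
      have "y \<oplus>\<^bsub>W\<^esub> T (x0 \<oplus>\<^bsub>V\<^esub> c \<odot>\<^bsub>V\<^esub> x) = (y \<oplus>\<^bsub>W\<^esub> T x0) \<oplus>\<^bsub>W\<^esub> c \<odot>\<^bsub>W\<^esub> T x"
        if "y \<in> Y" "x0 \<in> X0" "c \<in> carrier K" for y x0 c
      proof -
        have "y \<in> carrier W" "x0 \<in> carrier V" using that X0' Y' by auto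
        then show ?thesis using xc that by (simp add: W.module.M.a_assoc)
      qed
      note eq = this
      have "Y <+>\<^bsub>W\<^esub> T ` V.adjoin X0 x
          = {y \<oplus>\<^bsub>W\<^esub> T (x0 \<oplus>\<^bsub>V\<^esub> c \<odot>\<^bsub>V\<^esub> x) | y x0 c. y \<in> Y \<and> x0 \<in> X0 \<and> c \<in> carrier K}"
        unfolding V.adjoin_def set_add_def' by blast
      also have "\<dots> = {(y \<oplus>\<^bsub>W\<^esub> T x0) \<oplus>\<^bsub>W\<^esub> c \<odot>\<^bsub>W\<^esub> T x | y x0 c. y \<in> Y \<and> x0 \<in> X0 \<and> c \<in> carrier K}"
        by (intro Collect_cong ex_cong1) (auto simp: eq simp del: f_add f_smult)
      also have "\<dots> = W.adjoin (Y <+>\<^bsub>W\<^esub> T ` X0) (T x)"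
        unfolding W.adjoin_def set_add_def' by blast
      finally show ?thesis .
    qed
    moreover have "V.adjoin X0 x \<subseteq> X" unfolding V.adjoin_def using X0X X' x by auto
    moreover have "X0 \<subseteq> V.adjoin X0 x" using V.adjoin_incl X0' xc by blast
    ultimately have "good (V.adjoin X0 x)"
      using step X0 xc ZX0 by (auto simp: good_def)
    then show False using max step by fastforce
  qed
  then show "fd_subspace K W (Y <+>\<^bsub>W\<^esub> T ` X)"
    "subdim K W (Y <+>\<^bsub>W\<^esub> T ` X) + subdim K V {x \<in> X. T x \<in> Y} = subdim K W Y + subdim K V X"
    using X0 by (auto simp: good_def Z_def)
qed

section \<open>Restriction of scalars and coordinates\<close>

text \<open>
  The record does not mention the set of admissible scalars, so it describes \<open>F\<close> as a vector space
  over itself and over each of its subfields.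
\<close>
definition scalar_space :: "('f, 'y) ring_scheme \<Rightarrow> ('f, 'f) module" where
  "scalar_space F =
    \<lparr>carrier = carrier F, mult = mult F, one = one F, zero = zero F, add = add F, smult = mult F\<rparr>"

lemma vectorspace_restrict:
  assumes "field L" "subfield K L" "vectorspace L S"
  shows "vectorspace (L\<lparr>carrier := K\<rparr>) S"
proof -
  interpret L: field L by fact
  interpret S: vectorspace L S by fact
  have K: "K \<subseteq> carrier L" using subfieldE(3)[OF assms(2)] .
  interpret K: field "L\<lparr>carrier := K\<rparr>" using L.subfield_iff(2)[OF assms(2)] .
  have "module (L\<lparr>carrier := K\<rparr>) S"
    by (intro moduleI K.is_cring S.module.M.abelian_group_axioms)
       (use K in \<open>auto simp: subset_iff S.module.smult_l_distr S.module.smult_r_distr S.module.smult_assoc1\<close>)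
  then show ?thesis by (intro vectorspace.intro K.field_axioms)
qed

lemma vectorspace_scalar_space:
  assumes "field L"
  shows "vectorspace L (scalar_space L)"
proof -
  interpret L: field L by fact
  have "abelian_group (scalar_space L)"
    by (intro abelian_groupI)
       (auto simp: scalar_space_def L.a_ac intro: bexI[where x = "\<ominus>\<^bsub>L\<^esub> x" for x] L.l_neg)
  then have "module L (scalar_space L)"
    by (intro moduleI L.is_cring) (auto simp: scalar_space_def L.l_distr L.r_distr L.m_assoc)
  then show ?thesis by (intro vectorspace.intro L.field_axioms)
qed

lemma module_hom_restrict:
  assumes "T \<in> module_hom L S S'" "K \<subseteq> carrier L"
  shows "T \<in> module_hom (L\<lparr>carrier := K\<rparr>) S S'"
  using assms by (auto simp: module_hom_def)

lemma subspace_restrict: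
  assumes "field L" "subfield K L" "subspace L U S"
  shows "subspace (L\<lparr>carrier := K\<rparr>) U S"
proof -
  interpret S: vectorspace L S using assms(3) by (simp add: subspace_def)
  interpret K: vectorspace "L\<lparr>carrier := K\<rparr>" S
    by (rule vectorspace_restrict[OF assms(1,2) S.vectorspace_axioms])
  show ?thesis
    using S.subspaceD[OF assms(3)] subfieldE(3)[OF assms(2)] by (intro K.subspaceI) auto
qed

lemma scalar_multiples_hom:
  assumes "field L" "vectorspace L S" "w \<in> carrier S"
  shows "(\<lambda>p. p \<odot>\<^bsub>S\<^esub> w) \<in> module_hom L (scalar_space L) S"
proof -
  interpret S: vectorspace L S by fact
  show ?thesis using assms(3)
    by (auto simp: module_hom_def scalar_space_def S.module.smult_l_distr S.module.smult_assoc1)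
qed

text \<open>
  The set \<open>P w\<^sub>1 + \<dots> + P w\<^sub>n\<close>, where \<open>P\<close> is a set of scalars. With \<open>P\<close> the whole field it is the span
  of the list, with \<open>P\<close> a \<open>K\<close>-subspace of \<open>L\<close> it is a \<open>K\<close>-subspace, and with \<open>P\<close> finite it records
  which coefficients occur.
\<close>
fun coeff_span :: "('f, 'm, 'z) module_scheme \<Rightarrow> 'f set \<Rightarrow> 'm list \<Rightarrow> 'm set" where
  "coeff_span S P [] = {\<zero>\<^bsub>S\<^esub>}"
| "coeff_span S P (w # ws) = coeff_span S P ws <+>\<^bsub>S\<^esub> (\<lambda>p. p \<odot>\<^bsub>S\<^esub> w) ` P"

fun indep_list :: "('f, 'y) ring_scheme \<Rightarrow> ('f, 'm, 'z) module_scheme \<Rightarrow> 'm list \<Rightarrow> bool" where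
  "indep_list F S [] \<longleftrightarrow> True"
| "indep_list F S (w # ws) \<longleftrightarrow> w \<notin> coeff_span S (carrier F) ws \<and> indep_list F S ws"

lemma coeff_span_mono: "P \<subseteq> Q \<Longrightarrow> coeff_span S P ws \<subseteq> coeff_span S Q ws"
  by (induction ws) (auto simp: set_add_def')

lemma coeff_span_closed:
  assumes "vectorspace L S" "P \<subseteq> carrier L" "set ws \<subseteq> carrier S"
  shows "coeff_span S P ws \<subseteq> carrier S"
proof -
  interpret S: vectorspace L S by fact
  show ?thesis using assms(3)
  proof (induction ws)
    case (Cons w ws)
    have "v \<oplus>\<^bsub>S\<^esub> p \<odot>\<^bsub>S\<^esub> w \<in> carrier S" if "v \<in> coeff_span S P ws" "p \<in> P" for v p
    proof -
      have "v \<in> carrier S" "p \<in> carrier L" using that Cons assms(2) by auto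
      then show ?thesis using Cons.prems by simp
    qed
    then show ?case by (auto simp: set_add_def')
  qed simp
qed

text \<open>
  Prepending \<open>w\<close> to the list adds the image of \<open>P\<close> under \<open>p \<mapsto> p w\<close>, so the rank formula bounds the
  increase of the dimension by \<open>dim P\<close>.
\<close>
lemma fd_subspace_coeff_span:
  assumes "field L" "subfield K L" "vectorspace L S"
    and P: "fd_subspace (L\<lparr>carrier := K\<rparr>) (scalar_space L) P" and "set ws \<subseteq> carrier S"
  shows "fd_subspace (L\<lparr>carrier := K\<rparr>) S (coeff_span S P ws) \<and>
     subdim (L\<lparr>carrier := K\<rparr>) S (coeff_span S P ws)
      \<le> length ws * subdim (L\<lparr>carrier := K\<rparr>) (scalar_space L) P"
  using assms(5)
proof (induction ws)
  case Nil
  interpret S: vectorspace "L\<lparr>carrier := K\<rparr>" S by (rule vectorspace_restrict) fact+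
  show ?case by (simp add: S.fd_subspace_zero)
next
  case (Cons w ws)
  have K: "K \<subseteq> carrier L" using subfieldE(3)[OF assms(2)] .
  have hom: "(\<lambda>p. p \<odot>\<^bsub>S\<^esub> w) \<in> module_hom (L\<lparr>carrier := K\<rparr>) (scalar_space L) S"
    using Cons.prems by (intro module_hom_restrict K scalar_multiples_hom assms) auto
  note V = vectorspace_restrict[OF assms(1,2) vectorspace_scalar_space[OF assms(1)]]
    and S = vectorspace_restrict[OF assms(1-3)]
  show ?case using rank_formula[OF V S hom P, of "coeff_span S P ws"] Cons by auto
qed

lemma subdim_scalar_space:
  assumes "field L"
  shows "fd_subspace L (scalar_space L) (carrier L)" "subdim L (scalar_space L) (carrier L) = 1"
proof -
  interpret L: field L by fact
  interpret V: vectorspace L "scalar_space L" by (rule vectorspace_scalar_space) fact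
  have [simp]: "\<zero>\<^bsub>scalar_space L\<^esub> = \<zero>\<^bsub>L\<^esub>" "\<one>\<^bsub>L\<^esub> \<in> carrier (scalar_space L)"
    by (auto simp: scalar_space_def)
  have "V.adjoin {\<zero>\<^bsub>L\<^esub>} \<one>\<^bsub>L\<^esub> = {\<zero>\<^bsub>L\<^esub> \<oplus>\<^bsub>L\<^esub> c \<otimes>\<^bsub>L\<^esub> \<one>\<^bsub>L\<^esub> | c. c \<in> carrier L}"
    unfolding V.adjoin_def by (simp add: scalar_space_def)
  also have "\<dots> = {c | c. c \<in> carrier L}"
    by (intro Collect_cong ex_cong1) auto
  finally have "V.adjoin {\<zero>\<^bsub>L\<^esub>} \<one>\<^bsub>L\<^esub> = carrier L" by simp
  then show "fd_subspace L (scalar_space L) (carrier L)" "subdim L (scalar_space L) (carrier L) = 1"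
    using V.fd_subspace_adjoin[of "{\<zero>\<^bsub>L\<^esub>}" "\<one>\<^bsub>L\<^esub>"] V.fd_subspace_zero by simp_all
qed

lemma fd_subspace_coeff_span_field:
  assumes "field L" "vectorspace L S" "set ws \<subseteq> carrier S"
  shows "fd_subspace L S (coeff_span S (carrier L) ws)"
    and "subdim L S (coeff_span S (carrier L) ws) \<le> length ws"
  using fd_subspace_coeff_span[OF assms(1) field.carrier_is_subfield[OF assms(1)] assms(2), of "carrier L" ws]
    subdim_scalar_space[OF assms(1)] assms(3) by auto

text \<open>
  Independence over \<open>L\<close> makes each increase equal to \<open>dim P\<close>: if \<open>p w\<close> lies in the \<open>L\<close>-span of the
  tail for some \<open>p \<noteq> 0\<close>, then so does \<open>w\<close>.
\<close>
lemma subdim_coeff_span: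
  assumes "field L" "subfield K L" "vectorspace L S"
    and P: "fd_subspace (L\<lparr>carrier := K\<rparr>) (scalar_space L) P"
    and "set ws \<subseteq> carrier S" "indep_list L S ws"
  shows "subdim (L\<lparr>carrier := K\<rparr>) S (coeff_span S P ws)
      = length ws * subdim (L\<lparr>carrier := K\<rparr>) (scalar_space L) P"
  using assms(5,6)
proof (induction ws)
  case Nil
  interpret S: vectorspace "L\<lparr>carrier := K\<rparr>" S by (rule vectorspace_restrict) fact+
  show ?case by (simp add: S.fd_subspace_zero)
next
  case (Cons w ws)
  have K: "K \<subseteq> carrier L" using subfieldE(3)[OF assms(2)] .
  interpret L: field L by fact
  interpret S: vectorspace L S by fact
  have hom: "(\<lambda>p. p \<odot>\<^bsub>S\<^esub> w) \<in> module_hom (L\<lparr>carrier := K\<rparr>) (scalar_space L) S"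
    using Cons.prems by (intro module_hom_restrict K scalar_multiples_hom assms) auto
  note V = vectorspace_restrict[OF assms(1,2) vectorspace_scalar_space[OF assms(1)]]
    and S = vectorspace_restrict[OF assms(1-3)]
  have fd: "fd_subspace (L\<lparr>carrier := K\<rparr>) S (coeff_span S P ws)"
    using fd_subspace_coeff_span[OF assms(1,2,3) P, of ws] Cons.prems by auto
  have PL: "P \<subseteq> carrier L" "\<zero>\<^bsub>L\<^esub> \<in> P"
    using P vectorspace.subspaceD[OF V, of P] by (auto simp: fd_subspace_def scalar_space_def)
  have "{p \<in> P. p \<odot>\<^bsub>S\<^esub> w \<in> coeff_span S P ws} = {\<zero>\<^bsub>scalar_space L\<^esub>}"
  proof -
    have zero: "p = \<zero>\<^bsub>L\<^esub>" if p: "p \<in> P" "p \<odot>\<^bsub>S\<^esub> w \<in> coeff_span S P ws" for p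
    proof (rule ccontr)
      assume "p \<noteq> \<zero>\<^bsub>L\<^esub>"
      then have i: "inv\<^bsub>L\<^esub> p \<in> carrier L" "inv\<^bsub>L\<^esub> p \<otimes>\<^bsub>L\<^esub> p = \<one>\<^bsub>L\<^esub>"
        using p PL L.field_Units L.Units_inv_closed L.Units_l_inv by auto
      have "p \<odot>\<^bsub>S\<^esub> w \<in> coeff_span S (carrier L) ws" using p(2) coeff_span_mono[OF PL(1), of S ws] by (rule rev_subsetD)
      moreover have "subspace L (coeff_span S (carrier L) ws) S"
        using fd_subspace_coeff_span_field[OF assms(1,3)] Cons.prems by (auto simp: fd_subspace_def)
      ultimately have "inv\<^bsub>L\<^esub> p \<odot>\<^bsub>S\<^esub> (p \<odot>\<^bsub>S\<^esub> w) \<in> coeff_span S (carrier L) ws"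
        using S.subspaceD(4) i by blast
      moreover have "inv\<^bsub>L\<^esub> p \<odot>\<^bsub>S\<^esub> (p \<odot>\<^bsub>S\<^esub> w) = w"
        using S.module.smult_assoc1[of "inv\<^bsub>L\<^esub> p" p w] i p PL Cons.prems by auto
      ultimately show False using Cons.prems by simp
    qed
    have "\<zero>\<^bsub>L\<^esub> \<odot>\<^bsub>S\<^esub> w \<in> coeff_span S P ws"
    proof -
      have "subspace (L\<lparr>carrier := K\<rparr>) (coeff_span S P ws) S"
        using fd by (simp add: fd_subspace_def)
      moreover have "\<zero>\<^bsub>L\<^esub> \<odot>\<^bsub>S\<^esub> w = \<zero>\<^bsub>S\<^esub>" using Cons.prems by simp
      ultimately show ?thesis using vectorspace.subspaceD(2)[OF S] by metis
    qed
    then have "{p \<in> P. p \<odot>\<^bsub>S\<^esub> w \<in> coeff_span S P ws} = {\<zero>\<^bsub>L\<^esub>}"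
      using zero PL(2) by blast
    moreover have "\<zero>\<^bsub>scalar_space L\<^esub> = \<zero>\<^bsub>L\<^esub>" by (simp add: scalar_space_def)
    ultimately show ?thesis by (simp only:)
  qed
  then have "subdim (L\<lparr>carrier := K\<rparr>) (scalar_space L) {p \<in> P. p \<odot>\<^bsub>S\<^esub> w \<in> coeff_span S P ws} = 0"
    by (simp only: vectorspace.fd_subspace_zero[OF V])
  then show ?case
    using rank_formula(2)[OF V S hom P fd] Cons.IH Cons.prems by simp
qed

text \<open>
  A longest independent list of vectors in \<open>V\<close> spans \<open>V\<close>. Its length is bounded because the subfield
  \<open>K = L\<close> and the subspace \<open>P = L\<close> are allowed in the preceding computation of dimensions.
\<close>
lemma fd_subspace_basis_list:
  assumes "field L" "fd_subspace L S V"
  obtains ws where "set ws \<subseteq> V" "indep_list L S ws" "coeff_span S (carrier L) ws = V"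
    "length ws = subdim L S V"
proof -
  interpret L: field L by fact
  have sV: "subspace L V S" using assms(2) by (simp add: fd_subspace_def)
  interpret S: vectorspace L S using sV by (simp add: subspace_def)
  note V = S.subspaceD[OF sV]
  have dim: "subdim L S (coeff_span S (carrier L) ws) = length ws"
    if "set ws \<subseteq> carrier S" "indep_list L S ws" for ws
    using subdim_coeff_span[OF assms(1) L.carrier_is_subfield S.vectorspace_axioms, of "carrier L" ws]
      subdim_scalar_space[OF assms(1)] that by simp
  have incl: "coeff_span S (carrier L) ws \<subseteq> V" if "set ws \<subseteq> V" for ws
    using that V by (induction ws) (auto simp: set_add_def')
  define good where "good = (\<lambda>ws. set ws \<subseteq> V \<and> indep_list L S ws)"
  have le: "length ws \<le> subdim L S V" if "good ws" for ws
    using that dim[of ws] incl[of ws] V(1) S.fd_subspace_subset(2)[OF assms(2), of "coeff_span S (carrier L) ws"]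
      fd_subspace_coeff_span_field(1)[OF assms(1) S.vectorspace_axioms, of ws]
    by (auto simp: good_def fd_subspace_def)
  have "good []" by (simp add: good_def)
  then obtain ws where ws: "good ws" and max: "\<And>us. good us \<Longrightarrow> length us \<le> length ws"
    using ex_has_greatest_nat[of good "[]" length "Suc (subdim L S V)"] le by (metis less_Suc_eq_le)
  have "V \<subseteq> coeff_span S (carrier L) ws"
  proof
    fix v assume "v \<in> V"
    show "v \<in> coeff_span S (carrier L) ws"
    proof (rule ccontr)
      assume "v \<notin> coeff_span S (carrier L) ws"
      then have "good (v # ws)" using ws \<open>v \<in> V\<close> by (simp add: good_def)
      then show False using max by fastforce
    qed
  qed
  then have "coeff_span S (carrier L) ws = V" using incl ws by (auto simp: good_def)
  then show thesis using that[of ws] ws dim[of ws] V(1) by (auto simp: good_def)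
qed

lemma fd_subspace_Int_restrict:
  assumes "field L" "subfield K L" "vectorspace L S"
    and "fd_subspace (L\<lparr>carrier := K\<rparr>) S V" "fd_subspace L S U"
  shows "fd_subspace (L\<lparr>carrier := K\<rparr>) S (V \<inter> U)"
    and "subdim (L\<lparr>carrier := K\<rparr>) S (V \<inter> U) \<le> subdim (L\<lparr>carrier := K\<rparr>) S V"
proof -
  note VK = vectorspace_restrict[OF assms(1-3)]
  have "subspace (L\<lparr>carrier := K\<rparr>) (V \<inter> U) S"
    using assms(4,5) subspace_restrict[OF assms(1,2), of U S]
    by (intro vectorspace.subspace_Int[OF VK]) (auto simp: fd_subspace_def)
  from vectorspace.fd_subspace_subset(1,2)[OF VK assms(4) this]
  show "fd_subspace (L\<lparr>carrier := K\<rparr>) S (V \<inter> U)"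
    and "subdim (L\<lparr>carrier := K\<rparr>) S (V \<inter> U) \<le> subdim (L\<lparr>carrier := K\<rparr>) S V" by auto
qed

locale scalar_restriction =
  fixes L :: "('l, 'y) ring_scheme" and K :: "'l set" and S :: "('l, 'm, 'z) module_scheme"
  assumes field_L: "field L" and subfield_K: "subfield K L" and vectorspace_L: "vectorspace L S"
begin

abbreviation LK :: "('l, 'y) ring_scheme" where "LK \<equiv> L\<lparr>carrier := K\<rparr>"

lemmas vectorspace_K = vectorspace_restrict[OF field_L subfield_K vectorspace_L]
lemmas Int_restrict = fd_subspace_Int_restrict[OF field_L subfield_K vectorspace_L]

end

section \<open>Almost invariant subspaces for linear endomorphisms\<close>

text \<open>
  The subspace \<open>W\<close> stands for any space that contains all images of \<open>V\<close>, which leaves more freedom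
  than the sum of these images. If \<open>\<T>\<close> contains the identity, then \<open>V\<close> is \<open>\<epsilon>\<close>-almost invariant.
\<close>
definition has_almost_invariant ::
  "('f, 'y) ring_scheme \<Rightarrow> ('f, 'm, 'z) module_scheme \<Rightarrow> ('m \<Rightarrow> 'm) set \<Rightarrow> real \<Rightarrow> bool" where
  "has_almost_invariant F S \<T> \<epsilon> \<longleftrightarrow>
    (\<exists>V W. fd_subspace F S V \<and> fd_subspace F S W \<and> V \<noteq> {\<zero>\<^bsub>S\<^esub>} \<and> (\<forall>T\<in>\<T>. T ` V \<subseteq> W) \<and>
      real (subdim F S W) \<le> (1 + \<epsilon>) * real (subdim F S V))"

section \<open>Polynomial growth of commutative algebras\<close>

text \<open>
  A sequence of polynomial growth cannot grow by a factor above \<open>1 + \<delta>\<close> in every step, since then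
  it would grow exponentially.
\<close>
lemma power_growth:
  fixes d :: "nat \<Rightarrow> nat" and \<delta> :: real
  assumes "d 0 \<ge> 1" and poly: "\<And>n. d n \<le> Suc n ^ r" and \<delta>: "\<delta> > 0"
  shows "\<exists>n. real (d (Suc n)) \<le> (1 + \<delta>) * real (d n)"
proof (rule ccontr)
  assume "\<not> ?thesis"
  then have step: "real (d (Suc n)) > (1 + \<delta>) * real (d n)" for n by (auto simp: not_le)
  have exp_le: "(1 + \<delta>) ^ n \<le> real (d n)" for n
  proof (induction n)
    case (Suc n)
    have "(1 + \<delta>) ^ Suc n \<le> (1 + \<delta>) * real (d n)" using Suc \<delta> by simp
    then show ?case using step[of n] by linarith
  qed (use assms(1) in simp)
  define a where "a = ln (1 + \<delta>)"
  have a: "a > 0" using \<delta> by (simp add: a_def)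
  have "filterlim (\<lambda>n. a * real (Suc n)) at_top sequentially"
    by (rule filterlim_tendsto_pos_mult_at_top[OF tendsto_const a
          filterlim_compose[OF filterlim_real_sequentially filterlim_Suc]])
  then have "((\<lambda>n. (a * real (Suc n)) ^ r / exp (a * real (Suc n))) \<longlongrightarrow> 0) sequentially"
    using filterlim_compose[OF tendsto_power_div_exp_0[of r]] by blast
  then have "eventually (\<lambda>n. (a * real (Suc n)) ^ r / exp (a * real (Suc n)) < a ^ r * exp (- a)) sequentially"
    using a by (intro order_tendstoD(2)) auto
  then obtain n where "(a * real (Suc n)) ^ r / exp (a * real (Suc n)) < a ^ r * exp (- a)"
    by (auto simp: eventually_sequentially)
  then have "(a * real (Suc n)) ^ r < a ^ r * exp (- a) * exp (a * real (Suc n))"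
    by (simp add: divide_less_eq)
  also have "\<dots> = a ^ r * exp (a * real n)" by (simp add: exp_add[symmetric] algebra_simps)
  also have "exp (a * real n) = (1 + \<delta>) ^ n"
    using \<delta> by (simp add: a_def exp_of_nat2_mult)
  finally have "real (Suc n) ^ r < (1 + \<delta>) ^ n" using a by (simp add: power_mult_distrib)
  moreover have "real (d n) \<le> real (Suc n) ^ r" using poly[of n] by (metis of_nat_le_iff of_nat_power)
  ultimately show False using exp_le[of n] by linarith
qed

text \<open>
  The degree is bounded in each variable separately, so that there are at most \<open>(n + 1)\<^sup>r\<close> monomials
  in \<open>r\<close> variables and no binomial coefficients appear.
\<close>
fun monomials :: "('f, 'y) ring_scheme \<Rightarrow> nat \<Rightarrow> 'f list \<Rightarrow> 'f set" where
  "monomials L n [] = {\<one>\<^bsub>L\<^esub>}"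
| "monomials L n (c # cs) = (\<lambda>(i, m). c [^]\<^bsub>L\<^esub> i \<otimes>\<^bsub>L\<^esub> m) ` ({..n} \<times> monomials L n cs)"

lemma finite_monomials: "finite (monomials L n cs)"
  by (induction cs) auto

lemma card_monomials: "card (monomials L n cs) \<le> Suc n ^ length cs"
proof (induction cs)
  case (Cons c cs)
  have "card (monomials L n (c # cs)) \<le> card ({..n} \<times> monomials L n cs)"
    unfolding monomials.simps by (intro card_image_le finite_cartesian_product finite_monomials finite_atMost)
  also have "\<dots> \<le> Suc n ^ length (c # cs)" using mult_le_mono2[OF Cons, of "Suc n"] by (simp add: card_cartesian_product)
  finally show ?case .
qed simp

context cring
begin

lemma monomials_closed:
  "set cs \<subseteq> carrier R \<Longrightarrow> monomials R n cs \<subseteq> carrier R"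
  by (induction cs) (auto simp: subset_iff)

lemma one_mem_monomials:
  "set cs \<subseteq> carrier R \<Longrightarrow> \<one> \<in> monomials R n cs"
proof (induction cs)
  case (Cons c cs)
  have "\<one> = c [^] (0::nat) \<otimes> \<one>" by simp
  then show ?case using Cons by (auto intro!: image_eqI[where x = "(0, \<one>)"])
qed simp

lemma monomials_Suc: "monomials R n cs \<subseteq> monomials R (Suc n) cs"
  by (induction cs) auto

lemma mult_monomials:
  assumes "set cs \<subseteq> carrier R" "c \<in> set cs" "m \<in> monomials R n cs"
  shows "m \<otimes> c \<in> monomials R (Suc n) cs"
  using assms
proof (induction cs arbitrary: m)
  case (Cons b cs)
  obtain i k where m: "m = b [^] i \<otimes> k" "i \<le> n" "k \<in> monomials R n cs" using Cons.prems(3) by auto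
  have bc: "b \<in> carrier R" and kc: "k \<in> carrier R" and cc: "c \<in> carrier R"
    using Cons.prems monomials_closed[of cs n] m by auto
  show ?case
  proof (cases "c = b")
    case True
    then have "m \<otimes> c = b [^] Suc i \<otimes> k" using m bc kc by (simp add: m_ac)
    moreover have "k \<in> monomials R (Suc n) cs" using m(3) monomials_Suc by blast
    ultimately show ?thesis using m(2) by (auto intro!: image_eqI[where x = "(Suc i, k)"])
  next
    case False
    then have "k \<otimes> c \<in> monomials R (Suc n) cs" using Cons.IH[OF _ _ m(3)] Cons.prems by auto
    moreover have "m \<otimes> c = b [^] i \<otimes> (k \<otimes> c)" using m bc kc cc by (simp add: m_assoc)
    ultimately show ?thesis using m(2) by (auto intro!: image_eqI[where x = "(i, k \<otimes> c)"])
  qed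
qed simp

end

text \<open>
  The dimensions of the \<open>K\<close>-spans \<open>P\<^sub>n\<close> of the monomials in the elements of \<open>C\<close> grow polynomially, and
  multiplication by an element of \<open>C\<close> takes \<open>P\<^sub>n\<close> into \<open>P\<^bsub>n+1\<^esub>\<close>. The polynomial
  bound rests on the commutativity of \<open>L\<close>.
\<close>
lemma field_extension_almost_invariant:
  fixes \<delta> :: real
  assumes "field L" "subfield K L" and C: "finite C" "C \<subseteq> carrier L" and "\<delta> > 0"
  obtains P Q where "fd_subspace (L\<lparr>carrier := K\<rparr>) (scalar_space L) P"
    "fd_subspace (L\<lparr>carrier := K\<rparr>) (scalar_space L) Q"
    "P \<noteq> {\<zero>\<^bsub>L\<^esub>}"
    "\<And>p c. \<lbrakk>p \<in> P; c \<in> C\<rbrakk> \<Longrightarrow> p \<otimes>\<^bsub>L\<^esub> c \<in> Q"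
    "real (subdim (L\<lparr>carrier := K\<rparr>) (scalar_space L) Q)
      \<le> (1 + \<delta>) * real (subdim (L\<lparr>carrier := K\<rparr>) (scalar_space L) P)"
proof -
  interpret L: field L by fact
  have K: "K \<subseteq> carrier L" using subfieldE(3)[OF assms(2)] .
  interpret V: vectorspace "L\<lparr>carrier := K\<rparr>" "scalar_space L"
    by (rule vectorspace_restrict[OF assms(1,2) vectorspace_scalar_space[OF assms(1)]])
  have carr: "carrier (scalar_space L) = carrier L" by (simp add: scalar_space_def)
  have z: "\<zero>\<^bsub>scalar_space L\<^esub> = \<zero>\<^bsub>L\<^esub>" by (simp add: scalar_space_def)
  obtain cs where cs: "set cs = C" using finite_list[OF C(1)] by blast
  define P where "P = (\<lambda>n. V.span (monomials L n cs))"
  define d where "d = (\<lambda>n. subdim (L\<lparr>carrier := K\<rparr>) (scalar_space L) (P n))"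
  have mc: "monomials L n cs \<subseteq> carrier (scalar_space L)" for n
    using L.monomials_closed[of cs n] cs C carr by simp
  have fP: "fd_subspace (L\<lparr>carrier := K\<rparr>) (scalar_space L) (P n)" for n
    unfolding P_def by (rule V.fd_subspace_span(1)[OF finite_monomials mc])
  have sP: "subspace (L\<lparr>carrier := K\<rparr>) (P n) (scalar_space L)" for n
    using fP by (simp add: fd_subspace_def)
  have mP: "monomials L n cs \<subseteq> P n" for n unfolding P_def by (rule V.in_own_span[OF mc])
  have "\<one>\<^bsub>L\<^esub> \<in> P n" for n using mP L.one_mem_monomials[of cs n] cs C by auto
  then have nz: "P n \<noteq> {\<zero>\<^bsub>L\<^esub>}" for n using L.zero_not_one by force
  then have "d 0 \<ge> 1" using V.subdim_eq_0_iff[OF fP[of 0]] z by (simp add: d_def Suc_le_eq)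
  moreover have "d n \<le> Suc n ^ length cs" for n
    using V.fd_subspace_span(2)[OF finite_monomials mc, of n] card_monomials[of L n cs]
    unfolding d_def P_def by linarith
  ultimately obtain n where n: "real (d (Suc n)) \<le> (1 + \<delta>) * real (d n)"
    using power_growth[of d "length cs" \<delta>] assms(5) by blast
  have "p \<otimes>\<^bsub>L\<^esub> c \<in> P (Suc n)" if p: "p \<in> P n" and c: "c \<in> C" for p c
  proof -
    have cc: "c \<in> carrier L" using c C by auto
    \<comment> \<open>It suffices to treat monomials, because the elements with the required property form a subspace.\<close>
    define U where "U = {x \<in> carrier L. x \<otimes>\<^bsub>L\<^esub> c \<in> P (Suc n)}"
    note PS = V.subspaceD[OF sP[of "Suc n"]]
    have "subspace (L\<lparr>carrier := K\<rparr>) U (scalar_space L)"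
    proof (rule V.subspaceI)
      show "U \<subseteq> carrier (scalar_space L)" by (auto simp: U_def carr)
      show "\<zero>\<^bsub>scalar_space L\<^esub> \<in> U" using PS(2) cc by (simp add: U_def z)
    next
      fix x y assume "x \<in> U" "y \<in> U"
      then have xy: "x \<in> carrier L" "y \<in> carrier L"
        and "(x \<otimes>\<^bsub>L\<^esub> c) \<oplus>\<^bsub>scalar_space L\<^esub> (y \<otimes>\<^bsub>L\<^esub> c) \<in> P (Suc n)"
        using PS(3) by (auto simp: U_def)
      then have "(x \<oplus>\<^bsub>L\<^esub> y) \<otimes>\<^bsub>L\<^esub> c \<in> P (Suc n)"
        using cc by (simp add: scalar_space_def L.l_distr)
      then show "x \<oplus>\<^bsub>scalar_space L\<^esub> y \<in> U" using xy by (simp add: U_def scalar_space_def)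
    next
      fix k x assume "k \<in> carrier (L\<lparr>carrier := K\<rparr>)" "x \<in> U"
      then have kx: "k \<in> carrier L" "x \<in> carrier L"
        and "k \<odot>\<^bsub>scalar_space L\<^esub> (x \<otimes>\<^bsub>L\<^esub> c) \<in> P (Suc n)"
        using PS(4)[of k] K by (auto simp: U_def)
      then have "(k \<otimes>\<^bsub>L\<^esub> x) \<otimes>\<^bsub>L\<^esub> c \<in> P (Suc n)"
        using cc by (simp add: scalar_space_def L.m_assoc)
      then show "k \<odot>\<^bsub>scalar_space L\<^esub> x \<in> U" using kx by (simp add: U_def scalar_space_def)
    qed
    moreover have "monomials L n cs \<subseteq> U"
    proof
      fix m assume m: "m \<in> monomials L n cs"
      then have "m \<otimes>\<^bsub>L\<^esub> c \<in> P (Suc n)"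
        using L.mult_monomials[OF _ _ m, of c] cs c C mP[of "Suc n"] by auto
      then show "m \<in> U" using m mc carr by (auto simp: U_def)
    qed
    ultimately have "P n \<subseteq> U" unfolding P_def using V.span_is_subset V.is_module by blast
    then show ?thesis using p by (auto simp: U_def)
  qed
  then show thesis using that[of "P n" "P (Suc n)"] fP nz n by (auto simp: d_def)
qed

lemma finite_coefficients:
  assumes "finite X" "X \<subseteq> coeff_span S P ws"
  obtains C where "finite C" "C \<subseteq> P" "X \<subseteq> coeff_span S C ws"
proof -
  have "\<exists>C. finite C \<and> C \<subseteq> P \<and> x \<in> coeff_span S C ws" if "x \<in> coeff_span S P ws" for x
    using that
  proof (induction ws arbitrary: x)
    case (Cons w ws)
    then obtain v p where vp: "x = v \<oplus>\<^bsub>S\<^esub> p \<odot>\<^bsub>S\<^esub> w" "v \<in> coeff_span S P ws" "p \<in> P"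
      by (auto simp: set_add_def')
    obtain C where C: "finite C" "C \<subseteq> P" "v \<in> coeff_span S C ws" using Cons.IH[OF vp(2)] by blast
    then have "v \<in> coeff_span S (insert p C) ws"
      using coeff_span_mono[of C "insert p C" S ws] by blast
    then have "x \<in> coeff_span S (insert p C) (w # ws)" using vp by (auto simp: set_add_def')
    then show ?case using C vp by (intro exI[of _ "insert p C"]) auto
  qed (auto intro: exI[of _ "{}"])
  then obtain f where f: "\<And>x. x \<in> X \<Longrightarrow> finite (f x) \<and> f x \<subseteq> P \<and> x \<in> coeff_span S (f x) ws"
    using assms(2) by (metis subset_iff)
  show thesis
  proof (rule that[of "\<Union> (f ` X)"])
    show "X \<subseteq> coeff_span S (\<Union> (f ` X)) ws"
    proof
      fix x assume "x \<in> X"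
      then show "x \<in> coeff_span S (\<Union> (f ` X)) ws"
        using f coeff_span_mono[of "f x" "\<Union> (f ` X)" S ws] by blast
    qed
  qed (use f assms(1) in auto)
qed

text \<open>
  The passage from \<open>L\<close> to \<open>K\<close>: choose bases of \<open>V\<close> and \<open>W\<close> and replace the coefficient field \<open>L\<close> by the
  finite-dimensional \<open>K\<close>-subspaces \<open>P\<close> and \<open>Q\<close> that are almost invariant under the matrix entries.
\<close>
lemma (in scalar_restriction) has_almost_invariant_restrict:
  fixes \<epsilon> \<epsilon>' :: real
  assumes \<T>: "finite \<T>" "\<T> \<subseteq> module_hom L S S"
    and ai: "has_almost_invariant L S \<T> \<epsilon>" and eps: "0 < \<epsilon>" "\<epsilon> < \<epsilon>'"
  shows "has_almost_invariant LK S \<T> \<epsilon>'"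
proof -
  obtain V W where V: "fd_subspace L S V" and W: "fd_subspace L S W" and nonzero: "V \<noteq> {\<zero>\<^bsub>S\<^esub>}"
    and TVW: "\<And>T. T \<in> \<T> \<Longrightarrow> T ` V \<subseteq> W"
    and dim: "real (subdim L S W) \<le> (1 + \<epsilon>) * real (subdim L S V)"
    using ai unfolding has_almost_invariant_def by blast
  define \<delta> where "\<delta> = (\<epsilon>' - \<epsilon>) / (1 + \<epsilon>)"
  have \<delta>: "\<delta> > 0" and \<delta>\<epsilon>: "(1 + \<epsilon>) * (1 + \<delta>) = 1 + \<epsilon>'"
    using eps by (auto simp: \<delta>_def field_simps)
  interpret S: vectorspace L S by (rule vectorspace_L)
  define K' where "K' = L\<lparr>carrier := K\<rparr>"
  note assms_L = field_L subfield_K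
  note VK = vectorspace_K[folded K'_def]
  note VL = vectorspace_restrict[OF assms_L vectorspace_scalar_space[OF field_L], folded K'_def]
  obtain vs where vs: "set vs \<subseteq> V" "indep_list L S vs" "coeff_span S (carrier L) vs = V"
    "length vs = subdim L S V" using fd_subspace_basis_list[OF field_L V] .
  obtain ws where ws: "set ws \<subseteq> W" "indep_list L S ws" "coeff_span S (carrier L) ws = W"
    "length ws = subdim L S W" using fd_subspace_basis_list[OF field_L W] .
  have sV: "subspace L V S" and sW: "subspace L W S" using V W by (auto simp: fd_subspace_def)
  have vsc: "set vs \<subseteq> carrier S" and wsc: "set ws \<subseteq> carrier S"
    using vs ws S.subspaceD(1)[OF sV] S.subspaceD(1)[OF sW] by auto
  define X where "X = (\<Union>T\<in>\<T>. T ` set vs)"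
  have "finite X" "X \<subseteq> coeff_span S (carrier L) ws"
    using \<T>(1) TVW vs(1) ws(3) by (auto simp: X_def)
  then obtain C where C: "finite C" "C \<subseteq> carrier L" "X \<subseteq> coeff_span S C ws"
    by (rule finite_coefficients)
  obtain P Q where P: "fd_subspace K' (scalar_space L) P" and Q: "fd_subspace K' (scalar_space L) Q"
    and nz: "P \<noteq> {\<zero>\<^bsub>L\<^esub>}" and PQ: "\<And>p c. \<lbrakk>p \<in> P; c \<in> C\<rbrakk> \<Longrightarrow> p \<otimes>\<^bsub>L\<^esub> c \<in> Q"
    and dPQ: "real (subdim K' (scalar_space L) Q) \<le> (1 + \<delta>) * real (subdim K' (scalar_space L) P)"
    by (rule field_extension_almost_invariant[OF assms_L C(1,2) \<delta>, folded K'_def]) (rule that)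
  have PL: "P \<subseteq> carrier L"
    using P vectorspace.subspaceD(1)[OF VL, of P] by (auto simp: fd_subspace_def scalar_space_def)
  define V' where "V' = coeff_span S P vs"
  define W' where "W' = coeff_span S Q ws"
  have fV': "fd_subspace K' S V'" and fW': "fd_subspace K' S W'"
    and dW': "subdim K' S W' \<le> length ws * subdim K' (scalar_space L) Q"
    unfolding V'_def W'_def K'_def
    using fd_subspace_coeff_span[OF assms_L vectorspace_L P[unfolded K'_def] vsc]
      fd_subspace_coeff_span[OF assms_L vectorspace_L Q[unfolded K'_def] wsc] by auto
  have dV': "subdim K' S V' = length vs * subdim K' (scalar_space L) P"
    unfolding V'_def K'_def by (rule subdim_coeff_span[OF assms_L vectorspace_L P[unfolded K'_def] vsc vs(2)])
  \<comment> \<open>Scalars from \<open>P\<close> turn coefficients from \<open>C\<close> into coefficients from \<open>Q\<close>.\<close>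
  have scale: "p \<odot>\<^bsub>S\<^esub> x \<in> W'" if p: "p \<in> P" and x: "x \<in> X" for p x
  proof -
    have "p \<odot>\<^bsub>S\<^esub> x \<in> coeff_span S Q us" if "set us \<subseteq> carrier S" "x \<in> coeff_span S C us" for us
      using that
    proof (induction us arbitrary: x)
      case Nil
      then show ?case using p PL by auto
    next
      case (Cons u us)
      then obtain v c where vc: "x = v \<oplus>\<^bsub>S\<^esub> c \<odot>\<^bsub>S\<^esub> u" "v \<in> coeff_span S C us" "c \<in> C"
        by (auto simp: set_add_def')
      have carr: "v \<in> carrier S" "c \<in> carrier L" "p \<in> carrier L" "u \<in> carrier S"
        using coeff_span_closed[OF vectorspace_L C(2), of us] Cons.prems vc C(2) p PL by auto
      then have "p \<odot>\<^bsub>S\<^esub> x = p \<odot>\<^bsub>S\<^esub> v \<oplus>\<^bsub>S\<^esub> (p \<otimes>\<^bsub>L\<^esub> c) \<odot>\<^bsub>S\<^esub> u"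
        by (simp add: vc S.module.smult_r_distr S.module.smult_assoc1)
      moreover have "p \<odot>\<^bsub>S\<^esub> v \<in> coeff_span S Q us" using Cons.IH vc Cons.prems by auto
      ultimately show ?case using PQ[OF p vc(3)] by (auto simp: set_add_def')
    qed
    then show ?thesis using wsc x C(3) unfolding W'_def by blast
  qed
  have inv: "T ` V' \<subseteq> W'" if T: "T \<in> \<T>" for T
  proof -
    have sW': "subspace K' W' S" using fW' by (simp add: fd_subspace_def)
    have hom: "T \<in> module_hom L S S" using T \<T>(2) by auto
    have T0: "T \<zero>\<^bsub>S\<^esub> = \<zero>\<^bsub>S\<^esub>"
      using mod_hom.f0_is_0[of L S S T] hom vectorspace_L
      by (simp add: mod_hom_def mod_hom_axioms_def vectorspace_def)
    have "T ` coeff_span S P us \<subseteq> W'" if "set us \<subseteq> set vs" for us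
      using that
    proof (induction us)
      case Nil
      then show ?case using T0 vectorspace.subspaceD(2)[OF VK sW'] by simp
    next
      case (Cons u us)
      have "T (v \<oplus>\<^bsub>S\<^esub> p \<odot>\<^bsub>S\<^esub> u) \<in> W'" if "v \<in> coeff_span S P us" "p \<in> P" for v p
      proof -
        have carr: "v \<in> carrier S" "p \<in> carrier L" "u \<in> carrier S"
          using coeff_span_closed[OF vectorspace_L PL, of us] Cons.prems that PL vsc by auto
        have "T (v \<oplus>\<^bsub>S\<^esub> p \<odot>\<^bsub>S\<^esub> u) = T v \<oplus>\<^bsub>S\<^esub> p \<odot>\<^bsub>S\<^esub> T u"
          using module_hom_add[OF hom, of v "p \<odot>\<^bsub>S\<^esub> u"] module_hom_smult[OF hom, of p u] carr by simp
        moreover have "p \<odot>\<^bsub>S\<^esub> T u \<in> W'" using scale[OF that(2), of "T u"] T Cons.prems by (auto simp: X_def)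
        moreover have "T v \<in> W'" using Cons.IH Cons.prems that by auto
        ultimately show ?thesis using vectorspace.subspaceD(3)[OF VK sW'] by simp
      qed
      then show ?case by (auto simp: set_add_def')
    qed
    then show ?thesis by (simp add: V'_def)
  qed
  have "subdim L S V \<noteq> 0" using S.subdim_eq_0_iff[OF V] nonzero by simp
  moreover have "subdim K' (scalar_space L) P \<noteq> 0"
    using vectorspace.subdim_eq_0_iff[OF VL P] nz by (simp add: scalar_space_def)
  ultimately have "subdim K' S V' \<noteq> 0" using dV' vs(4) by simp
  then have nz': "V' \<noteq> {\<zero>\<^bsub>S\<^esub>}" using vectorspace.subdim_eq_0_iff[OF VK fV'] by simp
  have "real (subdim K' S W') \<le> real (subdim L S W) * real (subdim K' (scalar_space L) Q)"
    using dW' ws(4) by (metis of_nat_le_iff of_nat_mult)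
  also have "\<dots> \<le> ((1 + \<epsilon>) * real (subdim L S V)) * ((1 + \<delta>) * real (subdim K' (scalar_space L) P))"
    using dim dPQ by (intro mult_mono) (auto intro: order_trans[OF of_nat_0_le_iff])
  also have "\<dots> = ((1 + \<epsilon>) * (1 + \<delta>)) * real (subdim K' S V')" by (simp add: dV' vs(4))
  also have "\<dots> = (1 + \<epsilon>') * real (subdim K' S V')" by (simp only: \<delta>\<epsilon>)
  finally show ?thesis
    using fV' fW' nz' inv unfolding has_almost_invariant_def K'_def by blast
qed

section \<open>Density levels of a subspace over the smaller field\<close>

text \<open>
  The values \<open>f k\<close> will be maximal scores at level \<open>k\<close> and \<open>u k\<close> the dimension of a subspace where the
  maximum is attained; that is, minus \<open>u\<close> is a discrete derivative of \<open>f\<close>. Summation bounds the sum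
  of the \<open>u k\<close> below by \<open>a\<close> and that of the \<open>u' k\<close> above by \<open>b\<close>, so that not all quotients
  \<open>u' k / u k\<close> can exceed \<open>b / a\<close>.
\<close>
lemma telescoping_ratio:
  fixes f f' :: "nat \<Rightarrow> int" and u u' :: "nat \<Rightarrow> nat" and a b :: int and \<epsilon> :: real
  assumes step: "\<And>k. k \<ge> 1 \<Longrightarrow> f k \<le> f (Suc k) + int (u k)"
    and step': "\<And>k. k \<ge> 1 \<Longrightarrow> f' (Suc k) + int (u' (Suc k)) \<le> f' k"
    and start: "a \<le> f 1" "f' 1 + int (u' 1) \<le> b"
    and final: "f (Suc n) \<le> 0" "\<And>k. k \<ge> 1 \<Longrightarrow> 0 \<le> f' k"
    and "0 < a" "real_of_int b \<le> (1 + \<epsilon>) * real_of_int a" "\<epsilon> > 0"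
  obtains k where "k \<ge> 1" "u k > 0" "real (u' k) \<le> (1 + \<epsilon>) * real (u k)"
proof -
  have lower: "f 1 - f (Suc m) \<le> (\<Sum>k=1..m. int (u k))" for m
  proof (induction m)
    case (Suc m)
    then show ?case using step[of "Suc m"] by simp
  qed simp
  have upper: "(\<Sum>k=1..Suc m. int (u' k)) \<le> b - f' (Suc m)" for m
  proof (induction m)
    case 0
    then show ?case using start(2) by simp
  next
    case (Suc m)
    then show ?case using step'[of "Suc m"] by simp
  qed
  have pos: "a \<le> (\<Sum>k=1..n. int (u k))" using lower[of n] start(1) final(1) by linarith
  have up: "(\<Sum>k=1..n. int (u' k)) \<le> b"
  proof (cases n)
    case 0
    then show ?thesis using pos assms(7) by simp
  next
    case (Suc m)
    then show ?thesis using upper[of m] final(2)[of n] by simp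
  qed
  have "\<exists>k\<ge>1. u k > 0 \<and> real (u' k) \<le> (1 + \<epsilon>) * real (u k)"
  proof (rule ccontr)
    assume "\<not> ?thesis"
    then have big: "(1 + \<epsilon>) * real (u k) < real (u' k)" if "k \<ge> 1" "u k > 0" for k
      using that by (meson not_le)
    have "(\<Sum>k=1..n. (1 + \<epsilon>) * real (u k)) < (\<Sum>k=1..n. real (u' k))"
    proof (rule sum_strict_mono_ex1)
      show "\<forall>k\<in>{1..n}. (1 + \<epsilon>) * real (u k) \<le> real (u' k)"
      proof
        fix k assume "k \<in> {1..n}"
        then show "(1 + \<epsilon>) * real (u k) \<le> real (u' k)" using big[of k] by (cases "u k = 0") auto
      qed
      have "\<exists>k\<in>{1..n}. u k \<noteq> 0"
      proof (rule ccontr)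
        assume "\<not> ?thesis"
        then have "(\<Sum>k=1..n. int (u k)) = 0" by simp
        then show False using pos assms(7) by simp
      qed
      then show "\<exists>k\<in>{1..n}. (1 + \<epsilon>) * real (u k) < real (u' k)" using big by force
    qed simp
    also have "\<dots> = real_of_int (\<Sum>k=1..n. int (u' k))" by simp
    also have "\<dots> \<le> real_of_int b" using up by (simp only: of_int_le_iff)
    also have "\<dots> \<le> (1 + \<epsilon>) * real_of_int a" by fact
    also have "\<dots> \<le> (1 + \<epsilon>) * real_of_int (\<Sum>k=1..n. int (u k))"
      using pos assms(9) by (intro mult_left_mono) (auto simp only: of_int_le_iff)
    also have "\<dots> = (\<Sum>k=1..n. (1 + \<epsilon>) * real (u k))" by (simp add: sum_distrib_left)
    finally show False by simp
  qed
  then show thesis using that by blast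
qed

context scalar_restriction
begin

text \<open>
  This is \<open>N\<close> times \<open>dim\<^sub>K (V \<inter> U) - t dim\<^sub>L U\<close> for the level \<open>t = k / N\<close>.
\<close>
definition score :: "nat \<Rightarrow> nat \<Rightarrow> 'm set \<Rightarrow> 'm set \<Rightarrow> int" where
  "score N k V U = int N * int (subdim LK S (V \<inter> U)) - int k * int (subdim L S U)"

definition optimal :: "nat \<Rightarrow> nat \<Rightarrow> 'm set \<Rightarrow> 'm set \<Rightarrow> bool" where
  "optimal N k V U \<longleftrightarrow> fd_subspace L S U \<and> (\<forall>U'. fd_subspace L S U' \<longrightarrow> score N k V U' \<le> score N k V U)"

lemma zero_laws:
  assumes "x \<in> carrier S"
  shows "\<zero>\<^bsub>S\<^esub> \<oplus>\<^bsub>S\<^esub> x = x" "x \<oplus>\<^bsub>S\<^esub> \<zero>\<^bsub>S\<^esub> = x"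
proof -
  interpret vectorspace L S by (rule vectorspace_L)
  show "\<zero>\<^bsub>S\<^esub> \<oplus>\<^bsub>S\<^esub> x = x" "x \<oplus>\<^bsub>S\<^esub> \<zero>\<^bsub>S\<^esub> = x" using assms by auto
qed

lemma score_zero:
  assumes "fd_subspace LK S V"
  shows "score N k V {\<zero>\<^bsub>S\<^esub>} = 0"
proof -
  have "\<zero>\<^bsub>S\<^esub> \<in> V" using assms vectorspace.subspaceD(2)[OF vectorspace_K] by (simp add: fd_subspace_def)
  then have "V \<inter> {\<zero>\<^bsub>S\<^esub>} = {\<zero>\<^bsub>S\<^esub>}" by auto
  then show ?thesis
    by (simp add: score_def vectorspace.fd_subspace_zero[OF vectorspace_K]
        vectorspace.fd_subspace_zero[OF vectorspace_L])
qed

lemma score_le: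
  assumes "fd_subspace LK S V" "fd_subspace L S U"
  shows "score N k V U \<le> int N * int (subdim LK S V) - int k * int (subdim L S U)"
  using Int_restrict(2)[OF assms] by (simp add: score_def mult_left_mono)

lemma optimal_nonneg:
  assumes "fd_subspace LK S V" "optimal N k V U"
  shows "0 \<le> score N k V U"
  using assms score_zero[OF assms(1)] vectorspace.fd_subspace_zero(1)[OF vectorspace_L]
  by (metis optimal_def)

text \<open>
  Positivity of \<open>k\<close> bounds the dimension of the candidates; for \<open>k = 0\<close> all subspaces that
  contain \<open>V\<close> would be optimal.
\<close>
lemma largest_optimal_exists:
  assumes V: "fd_subspace LK S V" and k: "k \<ge> 1"
  obtains U where "optimal N k V U" "\<And>U'. optimal N k V U' \<Longrightarrow> subdim L S U' \<le> subdim L S U"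
proof -
  define d where "d = subdim LK S V"
  have le: "score N k V U + int (subdim L S U) \<le> int (N * d)" if "fd_subspace L S U" for U
  proof -
    have "int (subdim L S U) \<le> int k * int (subdim L S U)" using k mult_right_mono[of 1 "int k"] by simp
    then show ?thesis using score_le[OF V that, of N k] by (simp add: d_def)
  qed
  define good where "good = (\<lambda>U. fd_subspace L S U \<and> 0 \<le> score N k V U)"
  have "good {\<zero>\<^bsub>S\<^esub>}"
    using score_zero[OF V] vectorspace.fd_subspace_zero(1)[OF vectorspace_L] by (simp add: good_def)
  moreover have "\<forall>U. good U \<longrightarrow> nat (score N k V U) < Suc (N * d)"
  proof (intro allI impI)
    fix U assume "good U"
    then show "nat (score N k V U) < Suc (N * d)" using le[of U] unfolding good_def by linarith
  qed
  ultimately obtain U0 where U0: "good U0" "\<And>U. good U \<Longrightarrow> nat (score N k V U) \<le> nat (score N k V U0)"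
    using ex_has_greatest_nat[of good "{\<zero>\<^bsub>S\<^esub>}" "\<lambda>U. nat (score N k V U)"] by blast
  have "optimal N k V U0"
    unfolding optimal_def
  proof (intro conjI allI impI)
    show "fd_subspace L S U0" using U0 by (simp add: good_def)
    fix U assume "fd_subspace L S U"
    then show "score N k V U \<le> score N k V U0"
      using U0(1) U0(2)[of U] by (cases "0 \<le> score N k V U") (auto simp: good_def)
  qed
  moreover have "\<forall>U. optimal N k V U \<longrightarrow> subdim L S U < Suc (N * d)"
  proof (intro allI impI)
    fix U assume U: "optimal N k V U"
    then have "fd_subspace L S U" by (simp add: optimal_def)
    from le[OF this] optimal_nonneg[OF V U] show "subdim L S U < Suc (N * d)" by linarith
  qed
  ultimately obtain U where "optimal N k V U" "\<And>U'. optimal N k V U' \<Longrightarrow> subdim L S U' \<le> subdim L S U"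
    using ex_has_greatest_nat[of "optimal N k V" U0 "subdim L S"] by blast
  then show thesis using that by blast
qed

text \<open>
  The analogue of the vanishing of maps from a semistable object to one of smaller slope. With
  \<open>U\<^sub>0 = {x \<in> U. T x \<in> U'}\<close> and \<open>U\<^sub>1 = U' + T U\<close>, the rank formula over \<open>L\<close> says that
  \<open>dim\<^sub>L U\<^sub>1 + dim\<^sub>L U\<^sub>0 = dim\<^sub>L U' + dim\<^sub>L U\<close>. Over \<open>K\<close>, applied to \<open>V \<inter> U\<close> and \<open>V' \<inter> U'\<close>, it shows that
  \<open>dim\<^sub>K (V' \<inter> U\<^sub>1) + dim\<^sub>K (V \<inter> U\<^sub>0)\<close> is at least \<open>dim\<^sub>K (V' \<inter> U') + dim\<^sub>K (V \<inter> U)\<close>. Hence the scores of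
  \<open>U\<^sub>1\<close> and \<open>U\<^sub>0\<close> add up to at least those of \<open>U'\<close> and \<open>U\<close>. As \<open>U\<^sub>0\<close> does not beat \<open>U\<close>, the space \<open>U\<^sub>1\<close>
  is optimal together with \<open>U'\<close>, and it equals \<open>U'\<close> because \<open>U'\<close> is a largest optimal space.
\<close>
lemma optimal_functorial:
  assumes V: "fd_subspace LK S V" and V': "fd_subspace LK S V'"
    and T: "T \<in> module_hom L S S" "T ` V \<subseteq> V'"
    and U: "optimal N k V U" and U': "optimal N k V' U'"
    and largest: "\<And>U2. optimal N k V' U2 \<Longrightarrow> subdim L S U2 \<le> subdim L S U'"
  shows "T ` U \<subseteq> U'"
proof -
  have TK: "T \<in> module_hom LK S S"
    using module_hom_restrict[OF T(1) subfieldE(3)[OF subfield_K]] .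
  have fU: "fd_subspace L S U" and fU': "fd_subspace L S U'" using U U' by (auto simp: optimal_def)
  define U0 where "U0 = {x \<in> U. T x \<in> U'}"
  define U1 where "U1 = U' <+>\<^bsub>S\<^esub> T ` U"
  note rank_L = rank_formula[OF vectorspace_L vectorspace_L T(1) fU fU', folded U0_def U1_def]
  have sU: "subspace L U S" and sU': "subspace L U' S" using fU fU' by (auto simp: fd_subspace_def)
  note US = vectorspace.subspaceD[OF vectorspace_L sU] and U'S = vectorspace.subspaceD[OF vectorspace_L sU']
  have Tz: "T \<zero>\<^bsub>S\<^esub> = \<zero>\<^bsub>S\<^esub>"
    using mod_hom.f0_is_0[of L S S T] T(1) vectorspace_L
    by (simp add: mod_hom_def mod_hom_axioms_def vectorspace_def)
  have "subspace L U0 S"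
  proof (rule vectorspace.subspaceI[OF vectorspace_L])
    fix x y assume xy: "x \<in> U0" "y \<in> U0"
    then have "x \<in> carrier S" "y \<in> carrier S" using US by (auto simp: U0_def)
    then have "T (x \<oplus>\<^bsub>S\<^esub> y) = T x \<oplus>\<^bsub>S\<^esub> T y" using module_hom_add[OF T(1)] by simp
    then show "x \<oplus>\<^bsub>S\<^esub> y \<in> U0" using US U'S xy by (simp add: U0_def)
  next
    fix c x assume cx: "c \<in> carrier L" "x \<in> U0"
    then have "x \<in> carrier S" using US by (auto simp: U0_def)
    then have "T (c \<odot>\<^bsub>S\<^esub> x) = c \<odot>\<^bsub>S\<^esub> T x" using module_hom_smult[OF T(1)] cx by simp
    then show "c \<odot>\<^bsub>S\<^esub> x \<in> U0" using US U'S cx by (simp add: U0_def)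
  qed (use US U'S Tz in \<open>auto simp: U0_def\<close>)
  then have fU0: "fd_subspace L S U0"
    using vectorspace.fd_subspace_subset(1)[OF vectorspace_L fU] by (auto simp: U0_def)
  have fU1: "fd_subspace L S U1" by (rule rank_L(1))
  define X where "X = V \<inter> U"
  define Y where "Y = V' \<inter> U'"
  have fX: "fd_subspace LK S X" and fY: "fd_subspace LK S Y"
    using Int_restrict(1)[OF V fU] Int_restrict(1)[OF V' fU'] by (auto simp: X_def Y_def)
  note rank_K = rank_formula[OF vectorspace_K vectorspace_K TK fX fY]
  have "{x \<in> X. T x \<in> Y} = V \<inter> U0" using T(2) by (auto simp: X_def Y_def U0_def)
  moreover have "Y <+>\<^bsub>S\<^esub> T ` X \<subseteq> V' \<inter> U1"
  proof -
    have sV': "subspace LK V' S" using V' by (simp add: fd_subspace_def)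
    then show ?thesis
      using T(2) vectorspace.subspaceD(3)[OF vectorspace_K sV']
      unfolding set_add_def' X_def Y_def U1_def by blast
  qed
  then have "subdim LK S (Y <+>\<^bsub>S\<^esub> T ` X) \<le> subdim LK S (V' \<inter> U1)"
    using vectorspace.fd_subspace_subset(2)[OF vectorspace_K Int_restrict(1)[OF V' fU1]] rank_K(1)
    by (simp add: fd_subspace_def)
  ultimately have dK: "subdim LK S (V' \<inter> U') + subdim LK S (V \<inter> U)
      \<le> subdim LK S (V' \<inter> U1) + subdim LK S (V \<inter> U0)"
    using rank_K(2) by (simp add: X_def Y_def)
  then have "int N * int (subdim LK S (V' \<inter> U')) + int N * int (subdim LK S (V \<inter> U))
      \<le> int N * int (subdim LK S (V' \<inter> U1)) + int N * int (subdim LK S (V \<inter> U0))"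
    using mult_left_mono[of "int (subdim LK S (V' \<inter> U') + subdim LK S (V \<inter> U))" _ "int N"]
    by (simp add: distrib_left[symmetric] del: of_nat_add flip: of_nat_add)
  moreover have "int k * int (subdim L S U1) + int k * int (subdim L S U0)
      = int k * int (subdim L S U') + int k * int (subdim L S U)"
    using rank_L(2) by (simp add: distrib_left[symmetric] flip: of_nat_add)
  ultimately have "score N k V' U' + score N k V U \<le> score N k V' U1 + score N k V U0"
    unfolding score_def by linarith
  moreover have "score N k V U0 \<le> score N k V U" using U fU0 by (simp add: optimal_def)
  ultimately have "score N k V' U' \<le> score N k V' U1" by linarith
  then have "optimal N k V' U1" using U' fU1 unfolding optimal_def by (meson order_trans)
  then have "subdim L S U1 \<le> subdim L S U'" by (rule largest)
  moreover have "U' \<subseteq> U1"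
  proof
    fix y assume y: "y \<in> U'"
    then have "y \<in> carrier S" using U'S by auto
    then have "y = y \<oplus>\<^bsub>S\<^esub> T \<zero>\<^bsub>S\<^esub>" using Tz zero_laws(2) by metis
    then show "y \<in> U1" using y US(2) unfolding U1_def set_add_def' by blast
  qed
  ultimately have eq: "U' = U1"
    using vectorspace.fd_subspace_subset(3)[OF vectorspace_L fU1 sU'] by blast
  show ?thesis
  proof
    fix z assume "z \<in> T ` U"
    then obtain x where x: "x \<in> U" "z = T x" by auto
    then have "z \<in> carrier S" using US module_hom_closed[OF T(1)] by auto
    then have "z = \<zero>\<^bsub>S\<^esub> \<oplus>\<^bsub>S\<^esub> T x" using x zero_laws(1) by metis
    then have "z \<in> U1" using x U'S(2) unfolding U1_def set_add_def' by blast
    then show "z \<in> U'" using eq by simp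
  qed
qed

text \<open>
  The \<open>L\<close>-subspace generated by \<open>V\<close> contains all of \<open>V\<close> and has dimension at most \<open>dim\<^sub>K V\<close> over \<open>L\<close>.
\<close>
lemma score_one_lower_bound:
  assumes V: "fd_subspace LK S V" and U: "optimal N 1 V U"
  shows "(int N - 1) * int (subdim LK S V) \<le> score N 1 V U"
proof -
  have field_K: "field LK" using vectorspace_K by (simp add: vectorspace_def)
  obtain vs where vs: "set vs \<subseteq> V" "coeff_span S (carrier LK) vs = V" "length vs = subdim LK S V"
    using fd_subspace_basis_list[OF field_K V] by metis
  have sV: "subspace LK V S" using V by (simp add: fd_subspace_def)
  then have vsc: "set vs \<subseteq> carrier S" using vs vectorspace.subspaceD(1)[OF vectorspace_K] by blast
  define U0 where "U0 = coeff_span S (carrier L) vs"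
  have fU0: "fd_subspace L S U0" and d: "subdim L S U0 \<le> subdim LK S V"
    using fd_subspace_coeff_span_field[OF field_L vectorspace_L vsc] vs by (auto simp: U0_def)
  have "V \<subseteq> U0"
    using coeff_span_mono[of K "carrier L" S vs] subfieldE(3)[OF subfield_K] vs(2) by (simp add: U0_def)
  then have "V \<inter> U0 = V" by auto
  then have "(int N - 1) * int (subdim LK S V) \<le> score N 1 V U0"
    using d by (simp add: score_def left_diff_distrib)
  also have "\<dots> \<le> score N 1 V U" using U fU0 by (simp add: optimal_def)
  finally show ?thesis .
qed

lemma score_vanishes:
  assumes V: "fd_subspace LK S V" and U: "fd_subspace L S U"
  shows "score N (Suc (N * subdim LK S V)) V U \<le> 0"
proof (cases "subdim L S U = 0")
  case True
  then have "U = {\<zero>\<^bsub>S\<^esub>}" using vectorspace.subdim_eq_0_iff[OF vectorspace_L U] by simp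
  then show ?thesis using score_zero[OF V] by simp
next
  case False
  then have "int (N * subdim LK S V) \<le> int (Suc (N * subdim LK S V)) * int (subdim L S U)"
    using mult_mono[of "int (N * subdim LK S V)" "int (Suc (N * subdim LK S V))" 1 "int (subdim L S U)"]
    by simp
  then show ?thesis using score_le[OF V U, of N "Suc (N * subdim LK S V)"] by simp
qed

text \<open>
  The passage from \<open>K\<close> to \<open>L\<close>. The levels \<open>k / N\<close> start at \<open>1 / N\<close>, where the score is at least
  \<open>(N - 1) dim\<^sub>K V\<close>, and the resulting loss of a factor \<open>(N - 1) / N\<close> is absorbed into the
  difference between \<open>\<epsilon>\<close> and \<open>\<epsilon>'\<close>.
\<close>
lemma has_almost_invariant_extend:
  fixes \<epsilon> \<epsilon>' :: real
  assumes \<T>: "\<T> \<subseteq> module_hom L S S"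
    and ai: "has_almost_invariant LK S \<T> \<epsilon>" and eps: "0 < \<epsilon>" "\<epsilon> < \<epsilon>'"
  shows "has_almost_invariant L S \<T> \<epsilon>'"
proof -
  obtain V V' where V: "fd_subspace LK S V" and V': "fd_subspace LK S V'"
    and nonzero: "V \<noteq> {\<zero>\<^bsub>S\<^esub>}" and TVV': "\<And>T. T \<in> \<T> \<Longrightarrow> T ` V \<subseteq> V'"
    and dim: "real (subdim LK S V') \<le> (1 + \<epsilon>) * real (subdim LK S V)"
    using ai unfolding has_almost_invariant_def by blast
  define d where "d = subdim LK S V"
  define d' where "d' = subdim LK S V'"
  have d: "d > 0" using vectorspace.subdim_eq_0_iff[OF vectorspace_K V] nonzero by (simp add: d_def)
  \<comment> \<open>Chosen such that \<open>N / (N - 1) \<le> (1 + \<epsilon>') / (1 + \<epsilon>)\<close>.\<close>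
  obtain N :: nat where "(1 + \<epsilon>') / (\<epsilon>' - \<epsilon>) < real N" using reals_Archimedean2 by blast
  then have N: "1 + \<epsilon>' < real N * (\<epsilon>' - \<epsilon>)" using eps by (simp add: divide_less_eq)
  then have N_bound: "real N * (1 + \<epsilon>) \<le> (1 + \<epsilon>') * (real N - 1)" by (simp add: algebra_simps)
  have "\<exists>U. optimal N k V U" if "k \<ge> 1" for k using largest_optimal_exists[OF V that] by metis
  then obtain U where U: "\<And>k. k \<ge> 1 \<Longrightarrow> optimal N k V (U k)" by metis
  have "\<exists>U. optimal N k V' U \<and> (\<forall>U'. optimal N k V' U' \<longrightarrow> subdim L S U' \<le> subdim L S U)"
    if "k \<ge> 1" for k using largest_optimal_exists[OF V' that] by metis
  then obtain U' where U': "\<And>k. k \<ge> 1 \<Longrightarrow> optimal N k V' (U' k)"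
    "\<And>k W. \<lbrakk>k \<ge> 1; optimal N k V' W\<rbrakk> \<Longrightarrow> subdim L S W \<le> subdim L S (U' k)" by metis
  have fU: "fd_subspace L S (U k)" and fU': "fd_subspace L S (U' k)" if "k \<ge> 1" for k
    using U[OF that] U'(1)[OF that] by (auto simp: optimal_def)
  have shift: "score N k W X = score N (Suc k) W X + int (subdim L S X)" for k W X
    by (simp add: score_def algebra_simps)
  have "1 < real N"
  proof (rule ccontr)
    assume "\<not> 1 < real N"
    then have "(1 + \<epsilon>') * (real N - 1) \<le> 0" using eps by (simp add: mult_nonneg_nonpos)
    moreover have "0 < real N" using N eps by (cases N) auto
    then have "0 < real N * (1 + \<epsilon>)" using eps by simp
    ultimately show False using N_bound by linarith
  qed
  obtain k where k: "k \<ge> 1" "subdim L S (U k) > 0"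
    "real (subdim L S (U' k)) \<le> (1 + \<epsilon>') * real (subdim L S (U k))"
  proof (rule telescoping_ratio)
    show "score N k V (U k) \<le> score N (Suc k) V (U (Suc k)) + int (subdim L S (U k))" if "k \<ge> 1" for k
    proof -
      have "score N (Suc k) V (U k) \<le> score N (Suc k) V (U (Suc k))"
        using U[of "Suc k"] fU[OF that] by (simp add: optimal_def)
      then show ?thesis using shift[of k V "U k"] by linarith
    qed
    show "score N (Suc k) V' (U' (Suc k)) + int (subdim L S (U' (Suc k))) \<le> score N k V' (U' k)"
      if "k \<ge> 1" for k
    proof -
      have "score N k V' (U' (Suc k)) \<le> score N k V' (U' k)"
        using U'(1)[OF that] fU'[of "Suc k"] by (simp add: optimal_def)
      then show ?thesis using shift[of k V' "U' (Suc k)"] by linarith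
    qed
    show "(int N - 1) * int d \<le> score N 1 V (U 1)"
      using score_one_lower_bound[OF V U[of 1]] by (simp add: d_def)
    show "score N 1 V' (U' 1) + int (subdim L S (U' 1)) \<le> int N * int d'"
      using score_le[OF V' fU'[of 1], of N 1] by (simp add: d'_def)
    show "score N (Suc (N * d)) V (U (Suc (N * d))) \<le> 0"
      using score_vanishes[OF V fU, of "Suc (N * d)" N] by (simp add: d_def)
    show "0 \<le> score N k V' (U' k)" if "k \<ge> 1" for k using optimal_nonneg[OF V' U'(1)[OF that]] .
    show "0 < (int N - 1) * int d" using d \<open>1 < real N\<close> by simp
    have "real N * real d' \<le> real N * ((1 + \<epsilon>) * real d)"
      using dim by (intro mult_left_mono) (auto simp: d_def d'_def)
    also have "\<dots> \<le> ((1 + \<epsilon>') * (real N - 1)) * real d"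
      using mult_right_mono[OF N_bound, of "real d"] by (simp add: mult.assoc)
    finally show "real_of_int (int N * int d') \<le> (1 + \<epsilon>') * real_of_int ((int N - 1) * int d)"
      by (simp add: mult.assoc)
    show "\<epsilon>' > 0" using eps by simp
  qed
  have "T ` U k \<subseteq> U' k" if "T \<in> \<T>" for T
    using optimal_functorial[OF V V' _ TVV'[OF that] U[OF k(1)] U'(1)[OF k(1)] U'(2)[OF k(1)]] \<T> that
    by blast
  moreover have "U k \<noteq> {\<zero>\<^bsub>S\<^esub>}" using k vectorspace.subdim_eq_0_iff[OF vectorspace_L fU[OF k(1)]] by simp
  ultimately show ?thesis
    using fU[OF k(1)] fU'[OF k(1)] k(3) unfolding has_almost_invariant_def by blast
qed

end

section \<open>Modules over an algebra\<close>

text \<open>Scalars are central in the algebra, so the elements of the algebra act linearly.\<close>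
lemma action_hom:
  assumes "assoc_algebra F A" "left_module A M" "a \<in> carrier A"
  shows "(\<lambda>x. a \<odot>\<^bsub>M\<^esub> x) \<in> module_hom F (underlying_vs A M) (underlying_vs A M)"
proof -
  interpret assoc_algebra F A by fact
  interpret M: left_module A M by fact
  have "a \<odot>\<^bsub>M\<^esub> ((c \<odot>\<^bsub>A\<^esub> \<one>\<^bsub>A\<^esub>) \<odot>\<^bsub>M\<^esub> x) = (c \<odot>\<^bsub>A\<^esub> \<one>\<^bsub>A\<^esub>) \<odot>\<^bsub>M\<^esub> (a \<odot>\<^bsub>M\<^esub> x)"
    if "c \<in> carrier F" "x \<in> carrier M" for c x
  proof -
    have "a \<otimes>\<^bsub>A\<^esub> (c \<odot>\<^bsub>A\<^esub> \<one>\<^bsub>A\<^esub>) = (c \<odot>\<^bsub>A\<^esub> \<one>\<^bsub>A\<^esub>) \<otimes>\<^bsub>A\<^esub> a"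
      using assms(3) that by (simp add: smult_mult_left smult_mult_right)
    then show ?thesis using assms(3) that by (simp add: M.act_assoc[symmetric])
  qed
  then show ?thesis
    using assms(3) by (auto simp: module_hom_def underlying_vs_def M.act_closed M.act_r_distr)
qed

text \<open>
  The sum of translates is the smallest subspace that contains \<open>V\<close> and all its translates, and it
  is finite-dimensional with \<open>V\<close>. The induction over the list needs an arbitrary initial subspace in
  place of \<open>V\<close>, while the translated subspace remains \<open>V\<close>.
\<close>
lemma translate_sum_facts:
  assumes "assoc_algebra F A" "left_module A M" "set as \<subseteq> carrier A"
    and V: "fd_subspace F (underlying_vs A M) V"
  shows "fd_subspace F (underlying_vs A M) (translate_sum M as V)"
    and "V \<subseteq> translate_sum M as V"
    and "\<And>a. a \<in> set as \<Longrightarrow> (\<lambda>x. a \<odot>\<^bsub>M\<^esub> x) ` V \<subseteq> translate_sum M as V"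
    and "\<And>W. \<lbrakk>subspace F W (underlying_vs A M); V \<subseteq> W; \<And>a. a \<in> set as \<Longrightarrow> (\<lambda>x. a \<odot>\<^bsub>M\<^esub> x) ` V \<subseteq> W\<rbrakk>
      \<Longrightarrow> translate_sum M as V \<subseteq> W"
proof -
  define S where "S = underlying_vs A M"
  have S: "vectorspace F S"
    using assoc_algebra.vectorspace_underlying[OF assms(1,2)] by (simp add: S_def)
  interpret S: vectorspace F S by (rule S)
  have plus: "X <+>\<^bsub>M\<^esub> Y = X <+>\<^bsub>S\<^esub> Y" for X Y
    by (simp add: set_add_def' S_def underlying_vs_def)
  have sV: "subspace F V S" using V by (simp add: fd_subspace_def S_def)
  have "fd_subspace F S (foldl (\<lambda>W a. W <+>\<^bsub>M\<^esub> (\<lambda>v. a \<odot>\<^bsub>M\<^esub> v) ` V) W as) \<and>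
      W \<subseteq> foldl (\<lambda>W a. W <+>\<^bsub>M\<^esub> (\<lambda>v. a \<odot>\<^bsub>M\<^esub> v) ` V) W as \<and>
      (\<forall>a\<in>set as. (\<lambda>v. a \<odot>\<^bsub>M\<^esub> v) ` V \<subseteq> foldl (\<lambda>W a. W <+>\<^bsub>M\<^esub> (\<lambda>v. a \<odot>\<^bsub>M\<^esub> v) ` V) W as) \<and>
      (\<forall>U. subspace F U S \<and> W \<subseteq> U \<and> (\<forall>a\<in>set as. (\<lambda>v. a \<odot>\<^bsub>M\<^esub> v) ` V \<subseteq> U) \<longrightarrow>
        foldl (\<lambda>W a. W <+>\<^bsub>M\<^esub> (\<lambda>v. a \<odot>\<^bsub>M\<^esub> v) ` V) W as \<subseteq> U)"
    if "fd_subspace F S W" for W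
    using that assms(3)
  proof (induction as arbitrary: W)
    case (Cons a as)
    have hom: "(\<lambda>x. a \<odot>\<^bsub>M\<^esub> x) \<in> module_hom F S S"
      using action_hom[OF assms(1,2), of a] Cons.prems by (simp add: S_def)
    have sW: "subspace F W S" using Cons.prems by (simp add: fd_subspace_def)
    define X where "X = W <+>\<^bsub>S\<^esub> (\<lambda>x. a \<odot>\<^bsub>M\<^esub> x) ` V"
    have fX: "fd_subspace F S X"
      unfolding X_def using rank_formula(1)[OF S S hom] V Cons.prems by (simp add: S_def)
    have a0: "a \<odot>\<^bsub>M\<^esub> \<zero>\<^bsub>S\<^esub> = \<zero>\<^bsub>S\<^esub>"
      using mod_hom.f0_is_0[of F S S "\<lambda>x. a \<odot>\<^bsub>M\<^esub> x"] hom S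
      by (simp add: mod_hom_def mod_hom_axioms_def vectorspace_def)
    have WX: "W \<subseteq> X"
    proof
      fix w assume w: "w \<in> W"
      then have "w = w \<oplus>\<^bsub>S\<^esub> a \<odot>\<^bsub>M\<^esub> \<zero>\<^bsub>S\<^esub>" using a0 S.subspaceD(1)[OF sW] by auto
      then show "w \<in> X" using w S.subspaceD(2)[OF sV] unfolding X_def set_add_def' by blast
    qed
    have aX: "(\<lambda>x. a \<odot>\<^bsub>M\<^esub> x) ` V \<subseteq> X"
    proof
      fix y assume "y \<in> (\<lambda>x. a \<odot>\<^bsub>M\<^esub> x) ` V"
      then obtain v where v: "v \<in> V" "y = a \<odot>\<^bsub>M\<^esub> v" by auto
      then have "y \<in> carrier S" using module_hom_closed[OF hom] S.subspaceD(1)[OF sV] by auto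
      then have "y = \<zero>\<^bsub>S\<^esub> \<oplus>\<^bsub>S\<^esub> a \<odot>\<^bsub>M\<^esub> v" using v by simp
      then show "y \<in> X" using v S.subspaceD(2)[OF sW] unfolding X_def set_add_def' by blast
    qed
    have XU: "X \<subseteq> U" if "subspace F U S" "W \<subseteq> U" "(\<lambda>x. a \<odot>\<^bsub>M\<^esub> x) ` V \<subseteq> U" for U
      using that S.subspaceD(3)[OF that(1)] unfolding X_def set_add_def' by blast
    have IH: "fd_subspace F S (foldl (\<lambda>W a. W <+>\<^bsub>M\<^esub> (\<lambda>v. a \<odot>\<^bsub>M\<^esub> v) ` V) X as)"
      "X \<subseteq> foldl (\<lambda>W a. W <+>\<^bsub>M\<^esub> (\<lambda>v. a \<odot>\<^bsub>M\<^esub> v) ` V) X as"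
      "\<And>b. b \<in> set as \<Longrightarrow> (\<lambda>v. b \<odot>\<^bsub>M\<^esub> v) ` V \<subseteq> foldl (\<lambda>W a. W <+>\<^bsub>M\<^esub> (\<lambda>v. a \<odot>\<^bsub>M\<^esub> v) ` V) X as"
      "\<And>U. \<lbrakk>subspace F U S; X \<subseteq> U; \<And>b. b \<in> set as \<Longrightarrow> (\<lambda>v. b \<odot>\<^bsub>M\<^esub> v) ` V \<subseteq> U\<rbrakk>
        \<Longrightarrow> foldl (\<lambda>W a. W <+>\<^bsub>M\<^esub> (\<lambda>v. a \<odot>\<^bsub>M\<^esub> v) ` V) X as \<subseteq> U"
      using Cons.IH[OF fX] Cons.prems by auto
    have fold: "foldl (\<lambda>W a. W <+>\<^bsub>M\<^esub> (\<lambda>v. a \<odot>\<^bsub>M\<^esub> v) ` V) W (a # as)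
        = foldl (\<lambda>W a. W <+>\<^bsub>M\<^esub> (\<lambda>v. a \<odot>\<^bsub>M\<^esub> v) ` V) X as"
      by (simp add: X_def plus)
    show ?case
      unfolding fold
    proof (intro conjI ballI allI impI)
      fix b assume "b \<in> set (a # as)"
      then show "(\<lambda>v. b \<odot>\<^bsub>M\<^esub> v) ` V \<subseteq> foldl (\<lambda>W a. W <+>\<^bsub>M\<^esub> (\<lambda>v. a \<odot>\<^bsub>M\<^esub> v) ` V) X as"
        using IH(2,3) aX by (cases "b = a") auto
    next
      fix U assume "subspace F U S \<and> W \<subseteq> U \<and> (\<forall>a\<in>set (a # as). (\<lambda>v. a \<odot>\<^bsub>M\<^esub> v) ` V \<subseteq> U)"
      then show "foldl (\<lambda>W a. W <+>\<^bsub>M\<^esub> (\<lambda>v. a \<odot>\<^bsub>M\<^esub> v) ` V) X as \<subseteq> U"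
        using XU by (intro IH(4)) auto
    qed (use IH(1,2) WX in auto)
  qed simp
  from this[OF V[folded S_def]]
  show "fd_subspace F (underlying_vs A M) (translate_sum M as V)"
    and "V \<subseteq> translate_sum M as V"
    and "\<And>a. a \<in> set as \<Longrightarrow> (\<lambda>x. a \<odot>\<^bsub>M\<^esub> x) ` V \<subseteq> translate_sum M as V"
    and "\<And>W. \<lbrakk>subspace F W (underlying_vs A M); V \<subseteq> W; \<And>a. a \<in> set as \<Longrightarrow> (\<lambda>x. a \<odot>\<^bsub>M\<^esub> x) ` V \<subseteq> W\<rbrakk>
      \<Longrightarrow> translate_sum M as V \<subseteq> W"
    unfolding translate_sum_def S_def by auto
qed

text \<open>
  The sum of translates has \<open>V\<close> itself as a summand, while the target space in
  \<open>has_almost_invariant\<close> need not contain \<open>V\<close>; adding the unit of the algebra to \<open>B\<close> takes care of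
  this.
\<close>
lemma amenable_module_iff:
  fixes F :: "'f ring" and A :: "('f, 'a, 'x) module_scheme" and M :: "('a, 'm) module"
  assumes "assoc_algebra F A" "left_module A M"
  shows "amenable_module F A M \<longleftrightarrow>
    (\<forall>B \<epsilon>. finite B \<and> B \<subseteq> carrier A \<and> \<epsilon> > 0 \<longrightarrow>
      has_almost_invariant F (underlying_vs A M) ((\<lambda>a x. a \<odot>\<^bsub>M\<^esub> x) ` B) \<epsilon>)"
proof -
  define S where "S = underlying_vs A M"
  interpret left_module A M by fact
  have S: "vectorspace F S"
    using assoc_algebra.vectorspace_underlying[OF assms] by (simp add: S_def)
  show ?thesis
    unfolding S_def[symmetric]
  proof (intro iffI allI impI)
    fix B :: "'a set" and \<epsilon> :: real
    assume am: "amenable_module F A M" and B: "finite B \<and> B \<subseteq> carrier A \<and> \<epsilon> > 0"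
    obtain as where as: "set as = B" using finite_list B by blast
    then obtain V where "almost_invariant F A M as \<epsilon> V"
      using am B unfolding amenable_module_def by blast
    then have V: "fd_subspace F S V" "V \<noteq> {\<zero>\<^bsub>S\<^esub>}"
      "real (subdim F S (translate_sum M as V)) \<le> (1 + \<epsilon>) * real (subdim F S V)"
      by (auto simp: almost_invariant_def Let_def fd_subspace_def subdim_def S_def underlying_vs_def)
    have "set as \<subseteq> carrier A" using as B by simp
    note W = translate_sum_facts(1,3)[OF assms this V(1)[unfolded S_def], folded S_def]
    show "has_almost_invariant F S ((\<lambda>a x. a \<odot>\<^bsub>M\<^esub> x) ` B) \<epsilon>"
      unfolding has_almost_invariant_def
      using V W as by (intro exI[of _ V] exI[of _ "translate_sum M as V"] conjI ballI) auto
  next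
    assume ai: "\<forall>B \<epsilon>. finite B \<and> B \<subseteq> carrier A \<and> \<epsilon> > 0 \<longrightarrow>
      has_almost_invariant F S ((\<lambda>a x. a \<odot>\<^bsub>M\<^esub> x) ` B) \<epsilon>"
    show "amenable_module F A M"
      unfolding amenable_module_def
    proof (intro allI impI)
      fix as :: "'a list" and \<epsilon> :: real
      assume as: "set as \<subseteq> carrier A \<and> \<epsilon> > 0"
      then have "finite (insert \<one>\<^bsub>A\<^esub> (set as)) \<and> insert \<one>\<^bsub>A\<^esub> (set as) \<subseteq> carrier A \<and> \<epsilon> > 0" by simp
      then have "has_almost_invariant F S ((\<lambda>a x. a \<odot>\<^bsub>M\<^esub> x) ` insert \<one>\<^bsub>A\<^esub> (set as)) \<epsilon>" using ai by blast
      then obtain V W where V: "fd_subspace F S V" and W: "fd_subspace F S W" and nz: "V \<noteq> {\<zero>\<^bsub>S\<^esub>}"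
        and inv: "\<And>a. a \<in> insert \<one>\<^bsub>A\<^esub> (set as) \<Longrightarrow> (\<lambda>x. a \<odot>\<^bsub>M\<^esub> x) ` V \<subseteq> W"
        and dim: "real (subdim F S W) \<le> (1 + \<epsilon>) * real (subdim F S V)"
        unfolding has_almost_invariant_def by blast
      have "V \<subseteq> carrier M"
        using V vectorspace.subspaceD(1)[OF S, of V] by (simp add: fd_subspace_def S_def underlying_vs_def)
      then have "V \<subseteq> W" using inv[of "\<one>\<^bsub>A\<^esub>"] act_one by force
      moreover have sW: "subspace F W S" using W by (simp add: fd_subspace_def)
      ultimately have "translate_sum M as V \<subseteq> W"
        using translate_sum_facts(4)[OF assms _ V[unfolded S_def], of as W] as inv by (simp add: S_def)
      moreover have "fd_subspace F S (translate_sum M as V)"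
        using translate_sum_facts(1)[OF assms _ V[unfolded S_def]] as by (simp add: S_def)
      ultimately have "subdim F S (translate_sum M as V) \<le> subdim F S W"
        using vectorspace.fd_subspace_subset(2)[OF S W] by (simp add: fd_subspace_def)
      then have "real (subdim F S (translate_sum M as V)) \<le> (1 + \<epsilon>) * real (subdim F S V)"
        using dim by linarith
      then have "almost_invariant F A M as \<epsilon> V"
        using V nz by (simp add: almost_invariant_def Let_def fd_subspace_def subdim_def S_def underlying_vs_def)
      then show "\<exists>V. almost_invariant F A M as \<epsilon> V" by blast
    qed
  qed
qed

theorem amenable_module_restrict_scalars_iff:
  fixes L :: "'l ring" and A :: "('l, 'a, 'x) module_scheme" and M :: "('a, 'm) module"
  assumes "field L" "subfield K L" and A: "assoc_algebra L A" and M: "left_module A M"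
  shows "amenable_module (L\<lparr>carrier := K\<rparr>) A M \<longleftrightarrow> amenable_module L A M"
proof -
  \<comment> \<open>The record \<open>S\<close> is a vector space over \<open>L\<close> as well as over \<open>K\<close>.\<close>
  define S where "S = underlying_vs A M"
  have S: "vectorspace L S" using assoc_algebra.vectorspace_underlying[OF A M] by (simp add: S_def)
  interpret scalar_restriction L K S by (intro scalar_restriction.intro assms(1,2) S)
  have AK: "assoc_algebra LK A" by (rule assoc_algebra.restrict_scalars[OF A assms(2)])
  note iff_L = amenable_module_iff[OF A M, folded S_def]
    and iff_K = amenable_module_iff[OF AK M, folded S_def]
  have hom: "(\<lambda>a x. a \<odot>\<^bsub>M\<^esub> x) ` B \<subseteq> module_hom L S S" if "B \<subseteq> carrier A" for B
    using action_hom[OF A M] that by (auto simp: S_def)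
  show ?thesis
  proof
    assume am: "amenable_module LK A M"
    show "amenable_module L A M"
      unfolding iff_L
    proof (intro allI impI)
      fix B :: "'a set" and \<epsilon> :: real
      assume B: "finite B \<and> B \<subseteq> carrier A \<and> \<epsilon> > 0"
      then have "has_almost_invariant LK S ((\<lambda>a x. a \<odot>\<^bsub>M\<^esub> x) ` B) (\<epsilon> / 2)"
        using am iff_K by simp
      then show "has_almost_invariant L S ((\<lambda>a x. a \<odot>\<^bsub>M\<^esub> x) ` B) \<epsilon>"
        using B by (intro has_almost_invariant_extend[of _ "\<epsilon> / 2"] hom) auto
    qed
  next
    assume am: "amenable_module L A M"
    show "amenable_module LK A M"
      unfolding iff_K
    proof (intro allI impI)
      fix B :: "'a set" and \<epsilon> :: real
      assume B: "finite B \<and> B \<subseteq> carrier A \<and> \<epsilon> > 0"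
      then have "has_almost_invariant L S ((\<lambda>a x. a \<odot>\<^bsub>M\<^esub> x) ` B) (\<epsilon> / 2)"
        using am iff_L by simp
      then show "has_almost_invariant LK S ((\<lambda>a x. a \<odot>\<^bsub>M\<^esub> x) ` B) \<epsilon>"
        using B by (intro has_almost_invariant_restrict[of _ "\<epsilon> / 2"] hom) auto
    qed
  qed
qed

theorem corollary1p5:
  fixes L :: "'l ring" and K :: "'l set" and A :: "('l, 'a) module"
  assumes "field L" and "subfield K L" and "assoc_algebra L A"
  shows "(amenable_algebra (L\<lparr>carrier := K\<rparr>) A \<longleftrightarrow> amenable_algebra L A) \<and>
    (fully_amenable_algebra TYPE('m) (L\<lparr>carrier := K\<rparr>) A \<longleftrightarrow>
      fully_amenable_algebra TYPE('m) L A)"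
proof
  show "amenable_algebra (L\<lparr>carrier := K\<rparr>) A \<longleftrightarrow> amenable_algebra L A"
    unfolding amenable_algebra_def
    by (rule amenable_module_restrict_scalars_iff[OF assms assoc_algebra.left_module_regular[OF assms(3)]])
  show "fully_amenable_algebra TYPE('m) (L\<lparr>carrier := K\<rparr>) A \<longleftrightarrow> fully_amenable_algebra TYPE('m) L A"
    unfolding fully_amenable_algebra_def using amenable_module_restrict_scalars_iff[OF assms] by blast
qed

end
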